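(* Let $\mathcal{G}$ be a groupoid and let $R$ be a ring which is object unital and strongly $\mathcal{G}$-graded, with $1_{R_e}\neq 0$ for all $e\in\mathcal{G}_0$. Put $R_0=\bigoplus_{e\in\mathcal{G}_0}R_e$. Then the ring extension $R/R_0$ is separable if and only if for all $e\in\mathcal{G}_0$ the group $\mathcal{G}(e)$ is finite and $1_{R_e}\in \mathrm{tr}_e(Z(R_e))$.
   Context: Rings are associative but not necessarily unital. A groupoid $\mathcal{G}$ is a small category in which every morphism is an isomorphism, identified with its set of morphisms. For $\sigma\in\mathcal{G}$ put $d(\sigma)=\sigma^{-1}\sigma$ and $r(\sigma)=\sigma\sigma^{-1}$; $\mathcal{G}_0$ is the set of identity elements (the common image of $d$ and $r$); $\sigma\tau$ is defined iff $d(\sigma)=r(\tau)$; $\mathcal{G}_2$ is the set of pairs $(\sigma,\tau)$ with $\sigma\tau$ defined. For $e\in\mathcal{G}_0$, $\mathcal{G}(e)=\{\sigma\in\mathcal{G}\mid d(\sigma)=r(\sigma)=e\}$, a group. For subsets $X,Y$ of a ring, $XY$ is the set of finite sums of products $xy$, $x\in X$, $y\in Y$. A ring $R$ is $\mathcal{G}$-graded if $R=\bigoplus_{\sigma\in\mathcal{G}}R_\sigma$ for additive subgroups $R_\sigma$ with $R_\sigma R_\tau\subseteq R_{\sigma\tau}$ if $(\sigma,\tau)\in\mathcal{G}_2$ and $R_\sigma R_\tau=\{0\}$ otherwise. It is strongly graded if $R_\sigma R_\tau=R_{\sigma\tau}$ for all $(\sigma,\tau)\in\mathcal{G}_2$.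 It is object unital if each ring $R_e$, $e\in\mathcal{G}_0$, is unital and $1_{R_{r(\sigma)}}x=x1_{R_{d(\sigma)}}=x$ for all $\sigma\in\mathcal{G}$, $x\in R_\sigma$. A ring extension $A/B$ (i.e. $B$ is a subring of $A$) is separable if the multiplication map $\mu:A\otimes_B A\to A$, $\mu(a\otimes a')=aa'$, has an $A$-bimodule section $\delta:A\to A\otimes_B A$. $Z(S)$ denotes the center of a ring $S$; one has $Z(R_0)=\bigoplus_{e\in\mathcal{G}_0}Z(R_e)$. Trace: for each $\sigma\in\mathcal{G}$ fix $n_\sigma\in\mathbb{N}$, $u_\sigma^{(i)}\in R_\sigma$, $v_{\sigma^{-1}}^{(i)}\in R_{\sigma^{-1}}$ ($1\le i\le n_\sigma$) with $1_{R_{r(\sigma)}}=\sum_{i=1}^{n_\sigma}u_\sigma^{(i)}v_{\sigma^{-1}}^{(i)}$ (these exist by strong grading), taking $n_e=1$, $u_e^{(1)}=v_e^{(1)}=1_{R_e}$ for $e\in\mathcal{G}_0$. Put $\gamma_\sigma(x)=\sum_{i=1}^{n_\sigma}u_\sigma^{(i)}xv_{\sigma^{-1}}^{(i)}$ for $x\in R$; on $Z(R_0)$ this does not depend on the choices and takes values in $Z(R_0)$. If $\mathcal{G}(e)$ is finite, the trace function at $e$ is $\mathrm{tr}_e:Z(R_0)\to Z(R_0)$, $\mathrm{tr}_e(x)=\sum_{\sigma\in\mathcal{G}(e)}\gamma_\sigma(x)$. *)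

theory Defs
  imports "HOL-Library.Poly_Mapping" "HOL-Computational_Algebra.Group_Closure"
begin

section \<open>Groupoids\<close>

text \<open>
  A small category is given by its set of morphisms; objects are identified with identity
  morphisms. The composite \<open>cmp G \<sigma> \<tau>\<close> is meaningful only if \<open>dm G \<sigma> = rg G \<tau>\<close>.
\<close>

record 'g category =
  mor :: "'g set"
  dm :: "'g \<Rightarrow> 'g"
  rg :: "'g \<Rightarrow> 'g"
  cmp :: "'g \<Rightarrow> 'g \<Rightarrow> 'g"

definition composable :: "'g category \<Rightarrow> 'g \<Rightarrow> 'g \<Rightarrow> bool" where
  "composable G \<sigma> \<tau> \<longleftrightarrow> \<sigma> \<in> mor G \<and> \<tau> \<in> mor G \<and> dm G \<sigma> = rg G \<tau>"

definition small_category :: "'g category \<Rightarrow> bool" where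
  "small_category G \<longleftrightarrow>
     (\<forall>\<sigma>\<in>mor G. dm G \<sigma> \<in> mor G \<and> rg G \<sigma> \<in> mor G
        \<and> dm G (dm G \<sigma>) = dm G \<sigma> \<and> rg G (dm G \<sigma>) = dm G \<sigma>
        \<and> dm G (rg G \<sigma>) = rg G \<sigma> \<and> rg G (rg G \<sigma>) = rg G \<sigma>
        \<and> cmp G \<sigma> (dm G \<sigma>) = \<sigma> \<and> cmp G (rg G \<sigma>) \<sigma> = \<sigma>) \<and>
     (\<forall>\<sigma> \<tau>. composable G \<sigma> \<tau> \<longrightarrow>
        cmp G \<sigma> \<tau> \<in> mor G \<and> dm G (cmp G \<sigma> \<tau>) = dm G \<tau> \<and> rg G (cmp G \<sigma> \<tau>) = rg G \<sigma>) \<and>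
     (\<forall>\<sigma> \<tau> \<rho>. composable G \<sigma> \<tau> \<longrightarrow> composable G \<tau> \<rho> \<longrightarrow>
        cmp G (cmp G \<sigma> \<tau>) \<rho> = cmp G \<sigma> (cmp G \<tau> \<rho>))"

definition is_inverse :: "'g category \<Rightarrow> 'g \<Rightarrow> 'g \<Rightarrow> bool" where
  "is_inverse G \<sigma> \<tau> \<longleftrightarrow> composable G \<sigma> \<tau> \<and> composable G \<tau> \<sigma>
     \<and> cmp G \<sigma> \<tau> = rg G \<sigma> \<and> cmp G \<tau> \<sigma> = dm G \<sigma>"

definition groupoid :: "'g category \<Rightarrow> bool" where
  "groupoid G \<longleftrightarrow> small_category G \<and> (\<forall>\<sigma>\<in>mor G. \<exists>\<tau>. is_inverse G \<sigma> \<tau>)"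

definition ginv :: "'g category \<Rightarrow> 'g \<Rightarrow> 'g" where
  "ginv G \<sigma> = (THE \<tau>. is_inverse G \<sigma> \<tau>)"

definition identities :: "'g category \<Rightarrow> 'g set" where
  "identities G = dm G ` mor G"

definition isotropy :: "'g category \<Rightarrow> 'g \<Rightarrow> 'g set" where
  "isotropy G e = {\<sigma> \<in> mor G. dm G \<sigma> = e \<and> rg G \<sigma> = e}"

lemma identities_eq_range:
  assumes "groupoid G"
  shows "identities G = rg G ` mor G"
proof -
  have "dm G \<sigma> \<in> mor G \<and> rg G (dm G \<sigma>) = dm G \<sigma> \<and> rg G \<sigma> \<in> mor G \<and> dm G (rg G \<sigma>) = rg G \<sigma>"
    if "\<sigma> \<in> mor G" for \<sigma>
    using assms that by (simp add: groupoid_def small_category_def)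
  then show ?thesis
    unfolding identities_def by (metis (no_types, lifting) image_eqI image_subsetI subset_antisym)
qed

lemma is_inverse_unique:
  assumes "groupoid G" "is_inverse G \<sigma> \<tau>" "is_inverse G \<sigma> \<tau>'"
  shows "\<tau> = \<tau>'"
proof -
  have c: "composable G \<tau> \<sigma>" "composable G \<sigma> \<tau>'" and m: "\<tau> \<in> mor G" "\<tau>' \<in> mor G"
    and e: "dm G \<tau> = rg G \<sigma>" "rg G \<tau>' = dm G \<sigma>"
    using assms(2,3) by (auto simp: is_inverse_def composable_def)
  have "\<tau> = cmp G \<tau> (cmp G \<sigma> \<tau>')"
    using assms m e by (simp add: groupoid_def small_category_def is_inverse_def) metis
  also have "\<dots> = cmp G (cmp G \<tau> \<sigma>) \<tau>'"
    using assms(1) c by (simp add: groupoid_def small_category_def)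
  also have "\<dots> = \<tau>'"
    using assms m e by (simp add: groupoid_def small_category_def is_inverse_def) metis
  finally show ?thesis .
qed

lemma ginv_is_inverse:
  assumes "groupoid G" "\<sigma> \<in> mor G"
  shows "is_inverse G \<sigma> (ginv G \<sigma>)"
proof -
  obtain \<tau> where "is_inverse G \<sigma> \<tau>"
    using assms by (auto simp: groupoid_def)
  then show ?thesis
    unfolding ginv_def by (rule theI) (rule is_inverse_unique[OF assms(1) _ \<open>is_inverse G \<sigma> \<tau>\<close>])
qed

lemma dm_eq_ginv_cmp: "groupoid G \<Longrightarrow> \<sigma> \<in> mor G \<Longrightarrow> dm G \<sigma> = cmp G (ginv G \<sigma>) \<sigma>"
  and rg_eq_cmp_ginv: "groupoid G \<Longrightarrow> \<sigma> \<in> mor G \<Longrightarrow> rg G \<sigma> = cmp G \<sigma> (ginv G \<sigma>)"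
  using ginv_is_inverse by (metis is_inverse_def)+


section \<open>Subrings, units and centers\<close>

text \<open>
  The ambient rings are types of class \<^class>\<open>ring\<close>, which is the class of associative, not
  necessarily unital (nor nonzero) rings.
\<close>

definition is_add_subgroup :: "'r::ab_group_add set \<Rightarrow> bool" where
  "is_add_subgroup S \<longleftrightarrow> 0 \<in> S \<and> (\<forall>x\<in>S. \<forall>y\<in>S. x - y \<in> S)"

definition is_subring :: "'r::ring set \<Rightarrow> bool" where
  "is_subring S \<longleftrightarrow> is_add_subgroup S \<and> (\<forall>x\<in>S. \<forall>y\<in>S. x * y \<in> S)"

definition is_one_of :: "'r::ring set \<Rightarrow> 'r \<Rightarrow> bool" where
  "is_one_of S u \<longleftrightarrow> u \<in> S \<and> (\<forall>x\<in>S. u * x = x \<and> x * u = x)"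

definition unital :: "'r::ring set \<Rightarrow> bool" where
  "unital S \<longleftrightarrow> (\<exists>u. is_one_of S u)"

definition one_of :: "'r::ring set \<Rightarrow> 'r" where
  "one_of S = (THE u. is_one_of S u)"

definition ring_center :: "'r::ring set \<Rightarrow> 'r set" where
  "ring_center S = {z \<in> S. \<forall>x\<in>S. z * x = x * z}"

definition set_prod :: "'r::ring set \<Rightarrow> 'r set \<Rightarrow> 'r set" where
  "set_prod X Y = {\<Sum>i=1..n. x i * y i | (n::nat) x y. \<forall>i\<in>{1..n}. x i \<in> X \<and> y i \<in> Y}"

lemma is_one_of_one_of:
  assumes "unital S"
  shows "is_one_of S (one_of S)"
proof -
  obtain u where "is_one_of S u"
    using assms by (auto simp: unital_def)
  moreover have "w = u" if "is_one_of S w" for w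
    using that \<open>is_one_of S u\<close> unfolding is_one_of_def by metis
  ultimately show ?thesis
    unfolding one_of_def by (rule theI)
qed

lemma set_prod_mult: "x \<in> X \<Longrightarrow> y \<in> Y \<Longrightarrow> x * y \<in> set_prod X Y"
  unfolding set_prod_def
  by (intro CollectI exI[of _ "1::nat"] exI[of _ "\<lambda>_. x"] exI[of _ "\<lambda>_. y"]) simp


section \<open>Rings graded by a groupoid\<close>

definition finite_sums :: "'g set \<Rightarrow> ('g \<Rightarrow> 'r::ring set) \<Rightarrow> 'r set" where
  "finite_sums I R = {\<Sum>i\<in>F. c i | F c. finite F \<and> F \<subseteq> I \<and> (\<forall>i\<in>F. c i \<in> R i)}"

text \<open>The ambient ring is the internal direct sum of the family \<open>R\<close> of additive subgroups.\<close>

definition is_direct_sum :: "'g set \<Rightarrow> ('g \<Rightarrow> 'r::ring set) \<Rightarrow> bool" where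
  "is_direct_sum I R \<longleftrightarrow> (\<forall>i\<in>I. is_add_subgroup (R i)) \<and>
     (\<forall>x. \<exists>!c. finite {i. c i \<noteq> 0} \<and> (\<forall>i\<in>I. c i \<in> R i) \<and> (\<forall>i. i \<notin> I \<longrightarrow> c i = 0)
        \<and> x = (\<Sum>i | c i \<noteq> 0. c i))"

definition graded_ring :: "'g category \<Rightarrow> ('g \<Rightarrow> 'r::ring set) \<Rightarrow> bool" where
  "graded_ring G R \<longleftrightarrow> is_direct_sum (mor G) R \<and>
     (\<forall>\<sigma>\<in>mor G. \<forall>\<tau>\<in>mor G.
        if composable G \<sigma> \<tau> then set_prod (R \<sigma>) (R \<tau>) \<subseteq> R (cmp G \<sigma> \<tau>)
        else set_prod (R \<sigma>) (R \<tau>) = {0})"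

definition strongly_graded :: "'g category \<Rightarrow> ('g \<Rightarrow> 'r::ring set) \<Rightarrow> bool" where
  "strongly_graded G R \<longleftrightarrow> graded_ring G R \<and>
     (\<forall>\<sigma> \<tau>. composable G \<sigma> \<tau> \<longrightarrow> set_prod (R \<sigma>) (R \<tau>) = R (cmp G \<sigma> \<tau>))"

definition object_unital :: "'g category \<Rightarrow> ('g \<Rightarrow> 'r::ring set) \<Rightarrow> bool" where
  "object_unital G R \<longleftrightarrow> (\<forall>e\<in>identities G. unital (R e)) \<and>
     (\<forall>\<sigma>\<in>mor G. \<forall>x\<in>R \<sigma>. one_of (R (rg G \<sigma>)) * x = x \<and> x * one_of (R (dm G \<sigma>)) = x)"

text \<open>The subring \<open>R\<^sub>0\<close>; its decomposition is direct because that of the whole ring is.\<close>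

definition principal_subring :: "'g category \<Rightarrow> ('g \<Rightarrow> 'r::ring set) \<Rightarrow> 'r set" where
  "principal_subring G R = finite_sums (identities G) R"


section \<open>The trace functions\<close>

text \<open>
  The families \<open>u\<close> and \<open>v\<close> are both indexed by \<open>\<sigma>\<close>, although \<open>v \<sigma> i\<close> lies in the component of
  the inverse of \<open>\<sigma>\<close>.
\<close>

definition trace_choice ::
  "'g category \<Rightarrow> ('g \<Rightarrow> 'r::ring set) \<Rightarrow> ('g \<Rightarrow> nat) \<Rightarrow> ('g \<Rightarrow> nat \<Rightarrow> 'r) \<Rightarrow> ('g \<Rightarrow> nat \<Rightarrow> 'r) \<Rightarrow> bool" where
  "trace_choice G R n u v \<longleftrightarrow>
     (\<forall>\<sigma>\<in>mor G. (\<forall>i\<in>{1..n \<sigma>}. u \<sigma> i \<in> R \<sigma> \<and> v \<sigma> i \<in> R (ginv G \<sigma>))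
        \<and> one_of (R (rg G \<sigma>)) = (\<Sum>i=1..n \<sigma>. u \<sigma> i * v \<sigma> i)) \<and>
     (\<forall>e\<in>identities G. n e = 1 \<and> u e 1 = one_of (R e) \<and> v e 1 = one_of (R e))"

definition gam :: "('g \<Rightarrow> nat) \<Rightarrow> ('g \<Rightarrow> nat \<Rightarrow> 'r) \<Rightarrow> ('g \<Rightarrow> nat \<Rightarrow> 'r) \<Rightarrow> 'g \<Rightarrow> 'r::ring \<Rightarrow> 'r" where
  "gam n u v \<sigma> x = (\<Sum>i=1..n \<sigma>. u \<sigma> i * x * v \<sigma> i)"

text \<open>Only meaningful if the isotropy group at \<open>e\<close> is finite.\<close>

definition trace_at ::
  "'g category \<Rightarrow> ('g \<Rightarrow> nat) \<Rightarrow> ('g \<Rightarrow> nat \<Rightarrow> 'r) \<Rightarrow> ('g \<Rightarrow> nat \<Rightarrow> 'r) \<Rightarrow> 'g \<Rightarrow> 'r::ring \<Rightarrow> 'r" where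
  "trace_at G n u v e x = (\<Sum>\<sigma>\<in>isotropy G e. gam n u v \<sigma> x)"

lemma trace_choice_exists:
  assumes G: "groupoid G" and S: "strongly_graded G R" and U: "object_unital G R"
  shows "\<exists>n u v. trace_choice G R n u v"
proof -
  define P where "P \<sigma> k a b \<longleftrightarrow>
      (\<forall>i\<in>{1..k}. a i \<in> R \<sigma> \<and> b i \<in> R (ginv G \<sigma>)) \<and> one_of (R (rg G \<sigma>)) = (\<Sum>i=1..k. a i * b i) \<and>
      (\<sigma> \<in> identities G \<longrightarrow> k = 1 \<and> a 1 = one_of (R \<sigma>) \<and> b 1 = one_of (R \<sigma>))"
    for \<sigma> and k :: nat and a b
  have "\<exists>k a b. P \<sigma> k a b" if s: "\<sigma> \<in> mor G" for \<sigma>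
  proof (cases "\<sigma> \<in> identities G")
    case True
    then have d: "dm G \<sigma> = \<sigma>" "rg G \<sigma> = \<sigma>" "cmp G \<sigma> \<sigma> = \<sigma>"
      using G by (auto simp: identities_def groupoid_def small_category_def) metis
    have "is_inverse G \<sigma> \<sigma>"
      using d s by (simp add: is_inverse_def composable_def)
    then have i: "ginv G \<sigma> = \<sigma>"
      using is_inverse_unique[OF G] ginv_is_inverse[OF G s] by blast
    have "is_one_of (R \<sigma>) (one_of (R \<sigma>))"
      using U True by (simp add: object_unital_def is_one_of_one_of)
    then have "P \<sigma> 1 (\<lambda>_. one_of (R \<sigma>)) (\<lambda>_. one_of (R \<sigma>))"
      using d i by (simp add: P_def is_one_of_def)
    then show ?thesis by blast
  next
    case False
    have r: "rg G \<sigma> \<in> identities G"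
      using G s identities_eq_range by blast
    have I: "is_inverse G \<sigma> (ginv G \<sigma>)"
      using G s by (rule ginv_is_inverse)
    then have "set_prod (R \<sigma>) (R (ginv G \<sigma>)) = R (rg G \<sigma>)"
      using S by (auto simp: strongly_graded_def is_inverse_def)
    moreover have "one_of (R (rg G \<sigma>)) \<in> R (rg G \<sigma>)"
      using U r is_one_of_one_of by (auto simp: object_unital_def is_one_of_def)
    ultimately have "one_of (R (rg G \<sigma>)) \<in> set_prod (R \<sigma>) (R (ginv G \<sigma>))"
      by simp
    then show ?thesis
      using False unfolding P_def set_prod_def by blast
  qed
  then obtain n u v where "\<And>\<sigma>. \<sigma> \<in> mor G \<Longrightarrow> P \<sigma> (n \<sigma>) (u \<sigma>) (v \<sigma>)"
    by metis
  moreover have "identities G \<subseteq> mor G"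
    using G by (auto simp: identities_def groupoid_def small_category_def)
  ultimately have "trace_choice G R n u v"
    unfolding trace_choice_def P_def by blast
  then show ?thesis by blast
qed

lemma ring_center_component:
  assumes G: "groupoid G" and A: "graded_ring G R" and e: "e \<in> identities G"
  shows "ring_center (R e) \<subseteq> ring_center (principal_subring G R)"
proof
  fix z assume z: "z \<in> ring_center (R e)"
  then have zR: "z \<in> R e" by (simp add: ring_center_def)
  have id: "dm G f = f" "rg G f = f" "f \<in> mor G" if "f \<in> identities G" for f
    using G that by (auto simp: identities_def groupoid_def small_category_def)
  have orth: "x * y = 0" if "e1 \<in> identities G" "f1 \<in> identities G" "e1 \<noteq> f1" "x \<in> R e1" "y \<in> R f1"
    for e1 f1 x y
  proof -
    have "\<not> composable G e1 f1"
      using that id by (simp add: composable_def)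
    then have "set_prod (R e1) (R f1) = {0}"
      using A that id unfolding graded_ring_def by metis
    then show ?thesis using set_prod_mult that by blast
  qed
  have "z * x = x * z" if x: "x \<in> principal_subring G R" for x
  proof -
    obtain F c where F: "finite F" "F \<subseteq> identities G" "\<forall>i\<in>F. c i \<in> R i" "x = (\<Sum>i\<in>F. c i)"
      using x by (auto simp: principal_subring_def finite_sums_def)
    have "z * c i = c i * z" if "i \<in> F" for i
    proof (cases "i = e")
      case True
      then show ?thesis using z F that by (auto simp: ring_center_def)
    next
      case False
      then have "z * c i = 0" "c i * z = 0"
        using orth e zR F that by blast+
      then show ?thesis by simp
    qed
    then show ?thesis
      using F by (simp add: sum_distrib_left sum_distrib_right)
  qed
  moreover have "z \<in> principal_subring G R"
    unfolding principal_subring_def finite_sums_def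
    using zR e by (intro CollectI exI[of _ "{e}"] exI[of _ "\<lambda>_. z"]) simp
  ultimately show "z \<in> ring_center (principal_subring G R)"
    by (simp add: ring_center_def)
qed


section \<open>The tensor square over a subring and separable extensions\<close>

text \<open>
  For a subset \<open>B\<close> of the ring \<open>A\<close> (a type), \<open>A \<otimes>\<^sub>B A\<close> is the free abelian group on \<open>A \<times> A\<close> modulo
  the subgroup generated by the usual relations. No unit is involved. Tensors are represented by
  cosets, and the operations on tensors are defined on representatives; see the lemmas below for
  well-definedness.
\<close>

inductive_set tensor_relators :: "'a::ring set \<Rightarrow> ('a \<times> 'a \<Rightarrow>\<^sub>0 int) set" for B where
  add_left: "frag_of (x + x', y) - frag_of (x, y) - frag_of (x', y) \<in> tensor_relators B"
| add_right: "frag_of (x, y + y') - frag_of (x, y) - frag_of (x, y') \<in> tensor_relators B"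
| balanced: "b \<in> B \<Longrightarrow> frag_of (x * b, y) - frag_of (x, b * y) \<in> tensor_relators B"

definition tensor_eq :: "'a::ring set \<Rightarrow> (('a \<times> 'a \<Rightarrow>\<^sub>0 int) \<times> ('a \<times> 'a \<Rightarrow>\<^sub>0 int)) set" where
  "tensor_eq B = {(s, t). s - t \<in> group_closure (tensor_relators B)}"

definition tensor_square :: "'a::ring set \<Rightarrow> ('a \<times> 'a \<Rightarrow>\<^sub>0 int) set set" where
  "tensor_square B = UNIV // tensor_eq B"

definition tensor_class :: "'a::ring set \<Rightarrow> ('a \<times> 'a \<Rightarrow>\<^sub>0 int) \<Rightarrow> ('a \<times> 'a \<Rightarrow>\<^sub>0 int) set" where
  "tensor_class B s = tensor_eq B `` {s}"

definition pure_tensor :: "'a::ring set \<Rightarrow> 'a \<Rightarrow> 'a \<Rightarrow> ('a \<times> 'a \<Rightarrow>\<^sub>0 int) set" where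
  "pure_tensor B x y = tensor_class B (frag_of (x, y))"

definition tensor_add ::
  "'a::ring set \<Rightarrow> ('a \<times> 'a \<Rightarrow>\<^sub>0 int) set \<Rightarrow> ('a \<times> 'a \<Rightarrow>\<^sub>0 int) set \<Rightarrow> ('a \<times> 'a \<Rightarrow>\<^sub>0 int) set" where
  "tensor_add B X Y = (\<Union>s\<in>X. \<Union>t\<in>Y. tensor_class B (s + t))"

definition free_lmult :: "'a::ring \<Rightarrow> ('a \<times> 'a \<Rightarrow>\<^sub>0 int) \<Rightarrow> ('a \<times> 'a \<Rightarrow>\<^sub>0 int)" where
  "free_lmult a = frag_extend (\<lambda>(x, y). frag_of (a * x, y))"

definition free_rmult :: "('a \<times> 'a \<Rightarrow>\<^sub>0 int) \<Rightarrow> 'a::ring \<Rightarrow> ('a \<times> 'a \<Rightarrow>\<^sub>0 int)" where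
  "free_rmult s a = frag_extend (\<lambda>(x, y). frag_of (x, y * a)) s"

definition tensor_lmult ::
  "'a::ring set \<Rightarrow> 'a \<Rightarrow> ('a \<times> 'a \<Rightarrow>\<^sub>0 int) set \<Rightarrow> ('a \<times> 'a \<Rightarrow>\<^sub>0 int) set" where
  "tensor_lmult B a X = (\<Union>s\<in>X. tensor_class B (free_lmult a s))"

definition tensor_rmult ::
  "'a::ring set \<Rightarrow> ('a \<times> 'a \<Rightarrow>\<^sub>0 int) set \<Rightarrow> 'a \<Rightarrow> ('a \<times> 'a \<Rightarrow>\<^sub>0 int) set" where
  "tensor_rmult B X a = (\<Union>s\<in>X. tensor_class B (free_rmult s a))"

text \<open>Integer multiples; \<^const>\<open>of_int\<close> is not available without a unit.\<close>

definition int_mult :: "int \<Rightarrow> 'a::ab_group_add \<Rightarrow> 'a" where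
  "int_mult k x = (if 0 \<le> k then ((+) x ^^ nat k) 0 else - (((+) x ^^ nat (- k)) 0))"

definition free_mult :: "('a \<times> 'a \<Rightarrow>\<^sub>0 int) \<Rightarrow> 'a::ring" where
  "free_mult s = (\<Sum>p\<in>Poly_Mapping.keys s. int_mult (Poly_Mapping.lookup s p) (fst p * snd p))"

definition tensor_mult :: "('a \<times> 'a \<Rightarrow>\<^sub>0 int) set \<Rightarrow> 'a::ring" where
  "tensor_mult X = the_elem (free_mult ` X)"

definition is_bimodule_section ::
  "'a::ring set \<Rightarrow> ('a \<Rightarrow> ('a \<times> 'a \<Rightarrow>\<^sub>0 int) set) \<Rightarrow> bool" where
  "is_bimodule_section B \<delta> \<longleftrightarrow>
     (\<forall>a. \<delta> a \<in> tensor_square B) \<and>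
     (\<forall>a a'. \<delta> (a + a') = tensor_add B (\<delta> a) (\<delta> a')) \<and>
     (\<forall>a a'. \<delta> (a * a') = tensor_lmult B a (\<delta> a')) \<and>
     (\<forall>a a'. \<delta> (a * a') = tensor_rmult B (\<delta> a) a') \<and>
     (\<forall>a. tensor_mult (\<delta> a) = a)"

text \<open>The extension \<open>A/B\<close>, where \<open>A\<close> is the whole type.\<close>

definition separable_extension :: "'a::ring set \<Rightarrow> bool" where
  "separable_extension B \<longleftrightarrow> is_subring B \<and> (\<exists>\<delta>. is_bimodule_section B \<delta>)"


subsection \<open>Well-definedness\<close>

lemma equiv_tensor_eq: "equiv UNIV (tensor_eq B)"
proof (rule equivI)
  show "sym (tensor_eq B)"
  proof (rule symI)
    fix s t assume "(s, t) \<in> tensor_eq B"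
    then have "- (s - t) \<in> group_closure (tensor_relators B)"
      by (simp add: tensor_eq_def del: minus_diff_eq)
    then show "(t, s) \<in> tensor_eq B" by (simp add: tensor_eq_def)
  qed
  show "trans (tensor_eq B)"
  proof (rule transI)
    fix s t u assume "(s, t) \<in> tensor_eq B" "(t, u) \<in> tensor_eq B"
    then have "(s - t) + (t - u) \<in> group_closure (tensor_relators B)"
      by (intro group_closure_add) (simp_all add: tensor_eq_def)
    then show "(s, u) \<in> tensor_eq B" by (simp add: tensor_eq_def)
  qed
qed (auto simp: refl_on_def tensor_eq_def)

lemma tensor_class_eq_iff:
  "tensor_class B s = tensor_class B t \<longleftrightarrow> s - t \<in> group_closure (tensor_relators B)"
  using eq_equiv_class_iff[OF equiv_tensor_eq UNIV_I UNIV_I, of B s t]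
  by (simp add: tensor_class_def tensor_eq_def)

lemma mem_tensor_class_iff: "t \<in> tensor_class B s \<longleftrightarrow> tensor_class B t = tensor_class B s"
proof -
  have "t \<in> tensor_class B s \<longleftrightarrow> s - t \<in> group_closure (tensor_relators B)"
    by (simp add: tensor_class_def tensor_eq_def)
  then show ?thesis
    using tensor_class_eq_iff[of B s t] by (simp only: eq_commute[of "tensor_class B t"])
qed

lemma tensor_class_nonempty: "tensor_class B s \<noteq> {}"
proof
  assume "tensor_class B s = {}"
  moreover have "s \<in> tensor_class B s" by (simp add: mem_tensor_class_iff)
  ultimately show False by simp
qed

lemma tensor_class_in_square: "tensor_class B s \<in> tensor_square B"
  by (auto simp: tensor_class_def tensor_square_def intro: quotientI)

lemma tensor_square_cases:
  assumes "X \<in> tensor_square B"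
  obtains s where "X = tensor_class B s"
  using assms by (auto simp: tensor_class_def tensor_square_def elim: quotientE)

lemma tensor_lift:
  assumes "\<And>s t. f (s - t) = f s - f t"
    and "\<And>r. r \<in> tensor_relators B \<Longrightarrow> f r \<in> group_closure (tensor_relators B)"
  shows "(\<Union>t\<in>tensor_class B s. tensor_class B (f t)) = tensor_class B (f s)"
proof -
  have f0: "f 0 = 0" using assms(1)[of 0 0] by simp
  have *: "f r \<in> group_closure (tensor_relators B)" if "r \<in> group_closure (tensor_relators B)" for r
    using that
  proof induction
    case (base r)
    then show ?case using assms(2) f0 by auto
  next
    case (diff r r')
    then show ?case by (simp add: assms(1) group_closure.diff)
  qed
  have "tensor_class B (f t) = tensor_class B (f s)" if "t \<in> tensor_class B s" for t
    using that * by (simp add: mem_tensor_class_iff tensor_class_eq_iff flip: assms(1))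
  with tensor_class_nonempty[of B s] show ?thesis by simp
qed

lemma tensor_add_class:
  "tensor_add B (tensor_class B s) (tensor_class B t) = tensor_class B (s + t)"
proof -
  have "tensor_class B (s' + t') = tensor_class B (s + t)"
    if "s' \<in> tensor_class B s" "t' \<in> tensor_class B t" for s' t'
  proof -
    have "(s' - s) + (t' - t) \<in> group_closure (tensor_relators B)"
      using that by (intro group_closure_add) (simp_all add: mem_tensor_class_iff tensor_class_eq_iff)
    then show ?thesis by (simp add: tensor_class_eq_iff algebra_simps)
  qed
  with tensor_class_nonempty[of B s] tensor_class_nonempty[of B t] show ?thesis
    by (simp add: tensor_add_def)
qed

lemma tensor_lmult_class:
  "tensor_lmult B a (tensor_class B s) = tensor_class B (free_lmult a s)"
  unfolding tensor_lmult_def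
proof (rule tensor_lift)
  fix r assume "r \<in> tensor_relators B"
  then have "free_lmult a r \<in> tensor_relators B"
  proof cases
    case (add_left x x' y)
    with tensor_relators.add_left[of "a * x" "a * x'" y B] show ?thesis
      by (simp add: free_lmult_def frag_extend_diff distrib_left)
  next
    case (add_right x y y')
    with tensor_relators.add_right[of "a * x" y y' B] show ?thesis
      by (simp add: free_lmult_def frag_extend_diff distrib_left)
  next
    case (balanced b x y)
    with tensor_relators.balanced[of b B "a * x" y] show ?thesis
      by (simp add: free_lmult_def frag_extend_diff mult.assoc)
  qed
  then show "free_lmult a r \<in> group_closure (tensor_relators B)"
    by (simp add: group_closure.base)
qed (simp add: free_lmult_def frag_extend_diff)

lemma tensor_rmult_class:
  "tensor_rmult B (tensor_class B s) a = tensor_class B (free_rmult s a)"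
  unfolding tensor_rmult_def
proof (rule tensor_lift)
  fix r assume "r \<in> tensor_relators B"
  then have "free_rmult r a \<in> tensor_relators B"
  proof cases
    case (add_left x x' y)
    with tensor_relators.add_left[of x x' "y * a" B] show ?thesis
      by (simp add: free_rmult_def frag_extend_diff distrib_right)
  next
    case (add_right x y y')
    with tensor_relators.add_right[of x "y * a" "y' * a" B] show ?thesis
      by (simp add: free_rmult_def frag_extend_diff distrib_right)
  next
    case (balanced b x y)
    with tensor_relators.balanced[of b B x "y * a"] show ?thesis
      by (simp add: free_rmult_def frag_extend_diff mult.assoc)
  qed
  then show "free_rmult r a \<in> group_closure (tensor_relators B)"
    by (simp add: group_closure.base)
qed (simp add: free_rmult_def frag_extend_diff)

lemma int_mult_simps [simp]: "int_mult 0 x = 0" "int_mult 1 x = x"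
  by (simp_all add: int_mult_def)

lemma int_mult_succ: "int_mult (k + 1) x = x + int_mult k x"
proof -
  consider "k \<ge> 0" | "k = - 1" | "k < - 1" by linarith
  then show ?thesis
  proof cases
    case 1
    then show ?thesis by (simp add: int_mult_def nat_add_distrib)
  next
    case 3
    then have "nat (- k) = Suc (nat (- (k + 1)))" by simp
    with 3 show ?thesis by (simp add: int_mult_def)
  qed (simp add: int_mult_def)
qed

lemma int_mult_add: "int_mult (k + l) x = int_mult k x + int_mult l x"
proof (induction k rule: int_induct[where k = 0])
  case (step1 i)
  have "int_mult (i + 1 + l) x = int_mult ((i + l) + 1) x" by (simp add: algebra_simps)
  also have "\<dots> = x + (int_mult i x + int_mult l x)"
    by (simp only: int_mult_succ step1.IH)
  also have "\<dots> = int_mult (i + 1) x + int_mult l x"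
    by (simp add: int_mult_succ add.assoc)
  finally show ?case .
next
  case (step2 i)
  have "int_mult (i + l) x = x + int_mult (i - 1 + l) x"
    using int_mult_succ[of "i - 1 + l" x] by (simp add: algebra_simps)
  moreover have "int_mult i x = x + int_mult (i - 1) x"
    using int_mult_succ[of "i - 1" x] by simp
  ultimately show ?case using step2 by (simp add: add.assoc)
qed simp

lemma free_mult_of [simp]: "free_mult (frag_of (x, y)) = x * y"
  by (simp add: free_mult_def)

lemma free_mult_zero [simp]: "free_mult 0 = 0"
  by (simp add: free_mult_def)

lemma free_mult_add: "free_mult (s + t) = free_mult s + free_mult t"
proof -
  let ?K = "Poly_Mapping.keys s \<union> Poly_Mapping.keys t"
  have *: "free_mult w = (\<Sum>p\<in>?K. int_mult (Poly_Mapping.lookup w p) (fst p * snd p))"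
    if "Poly_Mapping.keys w \<subseteq> ?K" for w
    unfolding free_mult_def using that
    by (intro sum.mono_neutral_left) (auto simp: in_keys_iff)
  show ?thesis
    unfolding *[OF Poly_Mapping.keys_add] *[OF Un_upper1] *[OF Un_upper2]
    by (simp only: lookup_add int_mult_add sum.distrib)
qed

lemma free_mult_diff: "free_mult (s - t) = free_mult s - free_mult t"
  using free_mult_add[of "s - t" t] by simp

lemma tensor_mult_class:
  assumes "X = tensor_class B s"
  shows "tensor_mult X = free_mult s"
proof -
  have *: "free_mult r = 0" if "r \<in> group_closure (tensor_relators B)" for r
    using that
  proof induction
    case (base r)
    then consider "r = 0" | "r \<in> tensor_relators B" by blast
    then show ?case
    proof cases
      case 2
      then show ?thesis
        by cases (simp_all only: free_mult_diff free_mult_of distrib_left distrib_right mult.assoc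
            add_diff_cancel_left' diff_self)
    qed simp
  next
    case (diff r r')
    then show ?case by (simp add: free_mult_diff)
  qed
  have "free_mult t = free_mult s" if "t \<in> X" for t
    using that *[of "t - s"] assms by (simp add: mem_tensor_class_iff tensor_class_eq_iff free_mult_diff)
  moreover have "s \<in> X" using assms by (simp add: mem_tensor_class_iff)
  ultimately have "free_mult ` X = {free_mult s}" by (metis empty_iff image_constant_conv image_cong)
  then show ?thesis by (simp add: tensor_mult_def)
qed

lemma pure_tensor_add_left:
  "pure_tensor B (x + x') y = tensor_add B (pure_tensor B x y) (pure_tensor B x' y)"
proof -
  have "frag_of (x + x', y) - (frag_of (x, y) + frag_of (x', y)) \<in> tensor_relators B"
    using tensor_relators.add_left[of x x' y B] by (simp only: diff_diff_eq)
  then show ?thesis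
    unfolding pure_tensor_def tensor_add_class tensor_class_eq_iff
    by (simp only: group_closure.base insertI2)
qed

lemma pure_tensor_add_right:
  "pure_tensor B x (y + y') = tensor_add B (pure_tensor B x y) (pure_tensor B x y')"
proof -
  have "frag_of (x, y + y') - (frag_of (x, y) + frag_of (x, y')) \<in> tensor_relators B"
    using tensor_relators.add_right[of x y y' B] by (simp only: diff_diff_eq)
  then show ?thesis
    unfolding pure_tensor_def tensor_add_class tensor_class_eq_iff
    by (simp only: group_closure.base insertI2)
qed

lemma pure_tensor_balanced:
  "b \<in> B \<Longrightarrow> pure_tensor B (x * b) y = pure_tensor B x (b * y)"
  unfolding pure_tensor_def tensor_class_eq_iff
  by (simp only: group_closure.base insertI2 tensor_relators.balanced)

lemma pure_tensor_lmult:
  "tensor_lmult B a (pure_tensor B x y) = pure_tensor B (a * x) y"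
  by (simp add: pure_tensor_def tensor_lmult_class free_lmult_def)

lemma pure_tensor_rmult:
  "tensor_rmult B (pure_tensor B x y) a = pure_tensor B x (y * a)"
  by (simp add: pure_tensor_def tensor_rmult_class free_rmult_def)

lemma pure_tensor_mult:
  "tensor_mult (pure_tensor B x y) = x * y"
  using tensor_mult_class[OF pure_tensor_def[of B x y]] by simp

end

theory Submission
  imports Defs
begin

text \<open>
  A bimodule section is the same as a family \<open>t\<^sub>e\<close> (the images of the units \<open>\<one> e\<close>) of preimages
  of \<open>\<one> e\<close> in the tensor square with \<open>a t\<^sub>d = t\<^sub>r a\<close> for homogeneous \<open>a\<close> from \<open>d\<close> to \<open>r\<close>.
  Given such a family, let \<open>c \<sigma>\<close> be the image of \<open>t\<^sub>r\<close>, where \<open>r\<close> is the range of \<open>\<sigma>\<close>, under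
  \<open>x \<otimes> y \<mapsto> x\<^sub>\<sigma> y\<^sub>\<sigma>'\<close> with \<open>\<sigma>'\<close> the inverse of \<open>\<sigma>\<close>. These elements are central,
  \<open>\<gamma>\<^sub>\<tau> (c \<sigma>) = c (\<tau>\<sigma>)\<close>, and the sum of \<open>c \<sigma>\<close> over all \<open>\<sigma>\<close> with range \<open>e\<close> is \<open>\<one> e\<close>, with
  finitely many nonzero terms. Since the isotropy group at \<open>e\<close> acts freely on these \<open>\<sigma>\<close>, it is
  finite, and summing \<open>c\<close> over representatives of the orbits gives an element of trace \<open>\<one> e\<close>.
  Conversely, fix an object \<open>p\<close> in each component and a central \<open>z\<close> of trace \<open>\<one> p\<close>; then
  \<open>t\<^sub>e\<close> is the sum of \<open>u\<^sub>\<sigma> z \<otimes> v\<^sub>\<sigma>\<close> over all \<open>\<sigma>\<close> from \<open>p\<close> to \<open>e\<close>.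
\<close>

section \<open>Calculus in the tensor square\<close>

text \<open>Tensors are handled through representatives in the free abelian group. This rule carries
  equality of classes through the difference step of \<open>frag_induct\<close>.\<close>

lemma tensor_class_diff_cong:
  assumes "tensor_class B s = tensor_class B s'" "tensor_class B t = tensor_class B t'"
  shows "tensor_class B (s - t) = tensor_class B (s' - t')"
proof -
  have "(s - s') - (t - t') \<in> group_closure (tensor_relators B)"
    using assms unfolding tensor_class_eq_iff by (rule group_closure.diff)
  then show ?thesis by (simp add: tensor_class_eq_iff algebra_simps)
qed

lemma tensor_class_sum_cong:
  assumes "\<And>i. i \<in> I \<Longrightarrow> tensor_class B (f i) = tensor_class B (g i)"
  shows "tensor_class B (sum f I) = tensor_class B (sum g I)"
  using assms
  by (induction I rule: infinite_finite_induct) (simp_all flip: tensor_add_class)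

lemma tensor_class_lmult_cong:
  "tensor_class B s = tensor_class B t \<Longrightarrow>
    tensor_class B (free_lmult a s) = tensor_class B (free_lmult a t)"
  by (simp flip: tensor_lmult_class)

lemma free_mult_cong: "tensor_class B s = tensor_class B t \<Longrightarrow> free_mult s = free_mult t"
  by (metis tensor_mult_class)

lemma tensor_class_frag_add_left:
  "tensor_class B (frag_of (x + x', y)) = tensor_class B (frag_of (x, y) + frag_of (x', y))"
  using pure_tensor_add_left[of B x x' y] by (simp add: pure_tensor_def tensor_add_class)

lemma tensor_class_frag_add_right:
  "tensor_class B (frag_of (x, y + y')) = tensor_class B (frag_of (x, y) + frag_of (x, y'))"
  using pure_tensor_add_right[of B x y y'] by (simp add: pure_tensor_def tensor_add_class)

text \<open>Additivity at \<open>0 + 0\<close> makes this class equal to its own double, and one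
  copy cancels. The other three vanishing rules arise in the same way.\<close>

lemma tensor_class_frag_zero_left [simp]: "tensor_class B (frag_of (0, y)) = tensor_class B 0"
  using tensor_class_frag_add_left[of B 0 0 y] by (simp add: tensor_class_eq_iff)

lemma tensor_class_frag_zero_right [simp]: "tensor_class B (frag_of (x, 0)) = tensor_class B 0"
  using tensor_class_frag_add_right[of B x 0 0] by (simp add: tensor_class_eq_iff)

lemma tensor_class_frag_sum_left:
  "tensor_class B (frag_of (sum f I, y)) = tensor_class B (\<Sum>i\<in>I. frag_of (f i, y))"
  by (induction I rule: infinite_finite_induct)
    (simp_all add: tensor_class_frag_add_left flip: tensor_add_class)

lemma tensor_class_frag_sum_right:
  "tensor_class B (frag_of (x, sum f I)) = tensor_class B (\<Sum>i\<in>I. frag_of (x, f i))"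
  by (induction I rule: infinite_finite_induct)
    (simp_all add: tensor_class_frag_add_right flip: tensor_add_class)

lemma tensor_class_frag_balanced:
  "b \<in> B \<Longrightarrow> tensor_class B (frag_of (x * b, y)) = tensor_class B (frag_of (x, b * y))"
  using pure_tensor_balanced[of b B x y] by (simp add: pure_tensor_def)

lemma free_lmult_of [simp]: "free_lmult a (frag_of (x, y)) = frag_of (a * x, y)"
  and free_rmult_of [simp]: "free_rmult (frag_of (x, y)) a = frag_of (x, y * a)"
  and free_lmult_zero [simp]: "free_lmult a 0 = 0"
  and free_rmult_zero [simp]: "free_rmult 0 a = 0"
  by (simp_all add: free_lmult_def free_rmult_def)

lemma free_lmult_diff: "free_lmult a (s - t) = free_lmult a s - free_lmult a t"
  and free_rmult_diff: "free_rmult (s - t) a = free_rmult s a - free_rmult t a"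
  and free_lmult_add: "free_lmult a (s + t) = free_lmult a s + free_lmult a t"
  and free_rmult_add: "free_rmult (s + t) a = free_rmult s a + free_rmult t a"
  by (simp_all add: free_lmult_def free_rmult_def frag_extend_diff frag_extend_add)

lemma free_lmult_sum: "free_lmult a (sum f I) = (\<Sum>i\<in>I. free_lmult a (f i))"
  and free_rmult_sum: "free_rmult (sum f I) a = (\<Sum>i\<in>I. free_rmult (f i) a)"
  and free_mult_sum: "free_mult (sum f I) = (\<Sum>i\<in>I. free_mult (f i))"
  by (induction I rule: infinite_finite_induct)
    (simp_all add: free_lmult_add free_rmult_add free_mult_add)

text \<open>Closure under differences covers sums and negatives alike, so an identity between
  additive maps on the free group has to be checked on generators only.\<close>

lemma frag_induct [case_names zero one diff]:
  fixes s :: "'a \<Rightarrow>\<^sub>0 int"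
  assumes "P 0" "\<And>x. P (frag_of x)" "\<And>s t. P s \<Longrightarrow> P t \<Longrightarrow> P (s - t)"
  shows "P s"
  by (rule frag_induction[where S = UNIV and P = P]) (use assms in auto)

lemma free_lmult_lmult: "free_lmult a (free_lmult b s) = free_lmult (a * b) s"
proof (induction s rule: frag_induct)
  case (one p)
  then show ?case by (cases p) (simp add: mult.assoc)
qed (simp_all add: free_lmult_diff)

lemma free_lmult_rmult: "free_lmult a (free_rmult s b) = free_rmult (free_lmult a s) b"
proof (induction s rule: frag_induct)
  case (one p)
  then show ?case by (cases p) simp
qed (simp_all add: free_lmult_diff free_rmult_diff)

lemma free_rmult_rmult: "free_rmult (free_rmult s a) b = free_rmult s (a * b)"
proof (induction s rule: frag_induct)
  case (one p)
  then show ?case by (cases p) (simp add: mult.assoc)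
qed (simp_all add: free_rmult_diff)

lemma free_mult_lmult: "free_mult (free_lmult a s) = a * free_mult s"
proof (induction s rule: frag_induct)
  case (one p)
  then show ?case by (cases p) (simp add: mult.assoc)
qed (simp_all add: free_lmult_diff free_mult_diff right_diff_distrib)

lemma free_mult_rmult: "free_mult (free_rmult s a) = free_mult s * a"
proof (induction s rule: frag_induct)
  case (one p)
  then show ?case by (cases p) (simp add: mult.assoc)
qed (simp_all add: free_rmult_diff free_mult_diff left_diff_distrib)

text \<open>In \<open>s\<close> the action is additive on representatives already. In the scalar it
  is additive only modulo the relation that splits the left factor \<open>(a + b) * x\<close>, hence
  the passage to classes.\<close>

lemma tensor_class_lmult_add:
  "tensor_class B (free_lmult (a + b) s) = tensor_class B (free_lmult a s + free_lmult b s)"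
proof (induction s rule: frag_induct)
  case (one p)
  then show ?case by (cases p) (simp add: distrib_right tensor_class_frag_add_left)
next
  case (diff s t)
  show ?case
    using tensor_class_diff_cong[OF diff] by (simp add: free_lmult_diff algebra_simps)
qed simp

lemma tensor_class_rmult_add:
  "tensor_class B (free_rmult s (a + b)) = tensor_class B (free_rmult s a + free_rmult s b)"
proof (induction s rule: frag_induct)
  case (one p)
  then show ?case by (cases p) (simp add: distrib_left tensor_class_frag_add_right)
next
  case (diff s t)
  show ?case
    using tensor_class_diff_cong[OF diff] by (simp add: free_rmult_diff algebra_simps)
qed simp

lemma tensor_class_lmult_zero [simp]: "tensor_class B (free_lmult 0 s) = tensor_class B 0"
  using tensor_class_lmult_add[of B 0 0 s] by (simp add: tensor_class_eq_iff)

lemma tensor_class_rmult_zero [simp]: "tensor_class B (free_rmult s 0) = tensor_class B 0"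
  using tensor_class_rmult_add[of B s 0 0] by (simp add: tensor_class_eq_iff)

lemma tensor_class_lmult_sum:
  "tensor_class B (free_lmult (sum f I) s) = tensor_class B (\<Sum>i\<in>I. free_lmult (f i) s)"
  by (induction I rule: infinite_finite_induct)
    (simp_all add: tensor_class_lmult_add flip: tensor_add_class)

lemma tensor_class_rmult_sum:
  "tensor_class B (free_rmult s (sum f I)) = tensor_class B (\<Sum>i\<in>I. free_rmult s (f i))"
  by (induction I rule: infinite_finite_induct)
    (simp_all add: tensor_class_rmult_add flip: tensor_add_class)

section \<open>Groupoids\<close>

locale morphism_groupoid =
  fixes G :: "'g category"
  assumes groupoid: "groupoid G"
begin

abbreviation cmp_syntax (infixl "\<cdot>" 70) where "\<sigma> \<cdot> \<tau> \<equiv> cmp G \<sigma> \<tau>"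
abbreviation "M \<equiv> mor G"
abbreviation "d \<equiv> dm G"
abbreviation "r \<equiv> rg G"
abbreviation "iv \<equiv> ginv G"

lemma small_category: "small_category G"
  using groupoid by (simp add: groupoid_def)

lemma d_r_simps [simp]:
  assumes "\<sigma> \<in> M"
  shows "d \<sigma> \<in> M" "r \<sigma> \<in> M" "d (d \<sigma>) = d \<sigma>" "r (d \<sigma>) = d \<sigma>" "d (r \<sigma>) = r \<sigma>" "r (r \<sigma>) = r \<sigma>"
    "\<sigma> \<cdot> d \<sigma> = \<sigma>" "r \<sigma> \<cdot> \<sigma> = \<sigma>"
  using small_category assms by (simp_all add: small_category_def)

lemma cmp_simps [simp]:
  assumes "\<sigma> \<in> M" "\<tau> \<in> M" "d \<sigma> = r \<tau>"
  shows "\<sigma> \<cdot> \<tau> \<in> M" "d (\<sigma> \<cdot> \<tau>) = d \<tau>" "r (\<sigma> \<cdot> \<tau>) = r \<sigma>"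
  using small_category assms by (simp_all add: small_category_def composable_def)

lemma cmp_assoc:
  assumes "\<sigma> \<in> M" "\<tau> \<in> M" "\<rho> \<in> M" "d \<sigma> = r \<tau>" "d \<tau> = r \<rho>"
  shows "\<sigma> \<cdot> \<tau> \<cdot> \<rho> = \<sigma> \<cdot> (\<tau> \<cdot> \<rho>)"
  using small_category assms by (simp add: small_category_def composable_def)

lemma inv_simps [simp]:
  assumes "\<sigma> \<in> M"
  shows "iv \<sigma> \<in> M" "d (iv \<sigma>) = r \<sigma>" "r (iv \<sigma>) = d \<sigma>" "\<sigma> \<cdot> iv \<sigma> = r \<sigma>" "iv \<sigma> \<cdot> \<sigma> = d \<sigma>"
  using ginv_is_inverse[OF groupoid assms] by (auto simp: is_inverse_def composable_def)

lemma inv_eqI: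
  assumes "\<sigma> \<in> M" "\<tau> \<in> M" "d \<sigma> = r \<tau>" "d \<tau> = r \<sigma>" "\<sigma> \<cdot> \<tau> = r \<sigma>" "\<tau> \<cdot> \<sigma> = d \<sigma>"
  shows "iv \<sigma> = \<tau>"
  by (rule is_inverse_unique[OF groupoid ginv_is_inverse[OF groupoid]])
    (use assms in \<open>simp_all add: is_inverse_def composable_def\<close>)

lemma cmp_cancel_left:
  assumes "\<sigma> \<in> M" "\<tau> \<in> M"
  shows "d \<sigma> = r \<tau> \<Longrightarrow> iv \<sigma> \<cdot> (\<sigma> \<cdot> \<tau>) = \<tau>" "r \<sigma> = r \<tau> \<Longrightarrow> \<sigma> \<cdot> (iv \<sigma> \<cdot> \<tau>) = \<tau>"
  using assms by (simp_all flip: cmp_assoc)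

lemma cmp_cancel_right:
  assumes "\<sigma> \<in> M" "\<tau> \<in> M"
  shows "d \<sigma> = r \<tau> \<Longrightarrow> \<sigma> \<cdot> \<tau> \<cdot> iv \<tau> = \<sigma>" "d \<sigma> = d \<tau> \<Longrightarrow> \<sigma> \<cdot> iv \<tau> \<cdot> \<tau> = \<sigma>"
  using assms by (simp_all add: cmp_assoc) (metis d_r_simps(7))+

lemma inv_cmp:
  assumes "\<sigma> \<in> M" "\<tau> \<in> M" "d \<sigma> = r \<tau>"
  shows "iv (\<sigma> \<cdot> \<tau>) = iv \<tau> \<cdot> iv \<sigma>"
proof (rule inv_eqI)
  show "\<sigma> \<cdot> \<tau> \<cdot> (iv \<tau> \<cdot> iv \<sigma>) = r (\<sigma> \<cdot> \<tau>)"
    using assms by (simp add: cmp_assoc cmp_cancel_left)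
  show "iv \<tau> \<cdot> iv \<sigma> \<cdot> (\<sigma> \<cdot> \<tau>) = d (\<sigma> \<cdot> \<tau>)"
    using assms by (simp add: cmp_assoc cmp_cancel_left)
qed (use assms in simp_all)

lemma identitiesD [simp]:
  assumes "e \<in> identities G"
  shows "e \<in> M" "d e = e" "r e = e" "e \<cdot> e = e" "iv e = e"
proof -
  show *: "e \<in> M" "d e = e" "r e = e"
    using assms by (auto simp: identities_def)
  show "e \<cdot> e = e" using d_r_simps(7)[OF *(1)] * by simp
  then show "iv e = e" using * by (intro inv_eqI) simp_all
qed

lemma d_r_identities [simp]:
  assumes "\<sigma> \<in> M"
  shows "d \<sigma> \<in> identities G" "r \<sigma> \<in> identities G"
  using assms identities_eq_range[OF groupoid] unfolding identities_def by blast+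

definition hom :: "'g \<Rightarrow> 'g \<Rightarrow> 'g set" where
  "hom e f = {\<sigma> \<in> M. d \<sigma> = e \<and> r \<sigma> = f}"

lemma isotropy_eq_hom: "isotropy G e = hom e e"
  by (simp add: isotropy_def hom_def)

lemma bij_betw_cmp_left:
  assumes "\<tau> \<in> M"
  shows "bij_betw (\<lambda>\<sigma>. \<tau> \<cdot> \<sigma>) (hom e (d \<tau>)) (hom e (r \<tau>))"
  by (rule bij_betw_byWitness[where f' = "\<lambda>\<sigma>. iv \<tau> \<cdot> \<sigma>"])
    (use assms in \<open>auto simp: hom_def cmp_cancel_left\<close>)

lemma bij_betw_cmp_right:
  assumes "\<tau> \<in> M"
  shows "bij_betw (\<lambda>\<sigma>. \<sigma> \<cdot> \<tau>) (hom (r \<tau>) e) (hom (d \<tau>) e)"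
  by (rule bij_betw_byWitness[where f' = "\<lambda>\<sigma>. \<sigma> \<cdot> iv \<tau>"])
    (use assms in \<open>auto simp: hom_def cmp_cancel_right\<close>)

text \<open>A representative object of the connected component of \<open>e\<close>. The predicate
  under \<open>SOME\<close> depends on that component only, so all objects of a component get the
  same choice.\<close>

definition base :: "'g \<Rightarrow> 'g" where
  "base e = (SOME p. p \<in> identities G \<and> hom p e \<noteq> {})"

lemma base:
  assumes "e \<in> identities G"
  shows "base e \<in> identities G" "hom (base e) e \<noteq> {}"
proof -
  have "e \<in> hom e e" using assms by (simp add: hom_def)
  then have "base e \<in> identities G \<and> hom (base e) e \<noteq> {}"
    unfolding base_def using assms by - (rule someI[of _ e], blast)
  then show "base e \<in> identities G" "hom (base e) e \<noteq> {}" by simp_all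
qed

text \<open>Left translation by \<open>\<tau>\<close> is a bijection from
  \<open>hom p (d \<tau>)\<close> to \<open>hom p (r \<tau>)\<close>, so both choices are made from
  the same predicate.\<close>

lemma base_eq:
  assumes "\<tau> \<in> M"
  shows "base (d \<tau>) = base (r \<tau>)"
proof -
  have "hom p (d \<tau>) = {} \<longleftrightarrow> hom p (r \<tau>) = {}" for p
    using bij_betw_cmp_left[OF assms, of p] by (auto simp: bij_betw_def)
  then show ?thesis by (simp add: base_def)
qed

end

section \<open>Graded rings\<close>

locale direct_sum =
  fixes I :: "'g set" and R :: "'g \<Rightarrow> 'r::ring set"
  assumes direct_sum: "is_direct_sum I R"
begin

definition component :: "'r \<Rightarrow> 'g \<Rightarrow> 'r" where
  "component x = (THE c. finite {i. c i \<noteq> 0} \<and> (\<forall>i\<in>I. c i \<in> R i) \<and> (\<forall>i. i \<notin> I \<longrightarrow> c i = 0)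
        \<and> x = (\<Sum>i | c i \<noteq> 0. c i))"

lemma component:
  shows finite_component: "finite {i. component x i \<noteq> 0}"
    and component_in: "i \<in> I \<Longrightarrow> component x i \<in> R i"
    and component_outside: "i \<notin> I \<Longrightarrow> component x i = 0"
    and sum_component: "x = (\<Sum>i | component x i \<noteq> 0. component x i)"
proof -
  have "\<exists>!c. finite {i. c i \<noteq> 0} \<and> (\<forall>i\<in>I. c i \<in> R i) \<and> (\<forall>i. i \<notin> I \<longrightarrow> c i = 0)
        \<and> x = (\<Sum>i | c i \<noteq> 0. c i)"
    using direct_sum unfolding is_direct_sum_def by blast
  from theI'[OF this] show "finite {i. component x i \<noteq> 0}" "i \<in> I \<Longrightarrow> component x i \<in> R i"
    "i \<notin> I \<Longrightarrow> component x i = 0" "x = (\<Sum>i | component x i \<noteq> 0. component x i)"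
    unfolding component_def by blast+
qed

text \<open>\<open>F\<close> may be any finite set containing the support. This lets a difference be
  treated on the union of two supports.\<close>

lemma component_eqI:
  assumes "finite F" "\<And>i. i \<in> I \<Longrightarrow> c i \<in> R i" "\<And>i. i \<notin> I \<Longrightarrow> c i = 0" "\<And>i. i \<notin> F \<Longrightarrow> c i = 0"
    "x = (\<Sum>i\<in>F. c i)"
  shows "component x = c"
proof -
  have "{i. c i \<noteq> 0} \<subseteq> F" using assms(4) by auto
  moreover from this have "(\<Sum>i | c i \<noteq> 0. c i) = (\<Sum>i\<in>F. c i)"
    using assms(1) by (intro sum.mono_neutral_left) auto
  ultimately have "finite {i. c i \<noteq> 0} \<and> (\<forall>i\<in>I. c i \<in> R i) \<and> (\<forall>i. i \<notin> I \<longrightarrow> c i = 0)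
        \<and> x = (\<Sum>i | c i \<noteq> 0. c i)"
    using assms by (auto intro: finite_subset)
  moreover have "\<exists>!c. finite {i. c i \<noteq> 0} \<and> (\<forall>i\<in>I. c i \<in> R i) \<and> (\<forall>i. i \<notin> I \<longrightarrow> c i = 0)
        \<and> x = (\<Sum>i | c i \<noteq> 0. c i)"
    using direct_sum unfolding is_direct_sum_def by blast
  ultimately show ?thesis unfolding component_def by (intro the1_equality)
qed

lemma sum_component_superset:
  assumes "finite F" "{i. component x i \<noteq> 0} \<subseteq> F"
  shows "(\<Sum>i\<in>F. component x i) = x"
proof -
  have "(\<Sum>i | component x i \<noteq> 0. component x i) = (\<Sum>i\<in>F. component x i)"
    using assms by (intro sum.mono_neutral_left) auto
  then show ?thesis using sum_component[of x] by simp
qed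

lemma add_subgroup: "i \<in> I \<Longrightarrow> is_add_subgroup (R i)"
  using direct_sum by (simp add: is_direct_sum_def)

lemma zero_in: "i \<in> I \<Longrightarrow> 0 \<in> R i"
  and diff_in: "i \<in> I \<Longrightarrow> x \<in> R i \<Longrightarrow> y \<in> R i \<Longrightarrow> x - y \<in> R i"
  using add_subgroup by (auto simp: is_add_subgroup_def)

lemma add_in: "i \<in> I \<Longrightarrow> x \<in> R i \<Longrightarrow> y \<in> R i \<Longrightarrow> x + y \<in> R i"
  using diff_in[of i x "0 - y"] diff_in[of i 0 y] zero_in[of i] by simp

lemma sum_in: "i \<in> I \<Longrightarrow> (\<And>j. j \<in> F \<Longrightarrow> f j \<in> R i) \<Longrightarrow> sum f F \<in> R i"
  by (induction F rule: infinite_finite_induct) (auto intro: zero_in add_in)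

lemma component_diff: "component (x - y) i = component x i - component y i"
proof -
  let ?F = "{i. component x i \<noteq> 0} \<union> {i. component y i \<noteq> 0}"
  have "component (x - y) = (\<lambda>i. component x i - component y i)"
  proof (rule component_eqI)
    show "finite ?F" by (simp add: finite_component)
    then show "x - y = (\<Sum>i\<in>?F. component x i - component y i)"
      unfolding sum_subtractf by (simp add: sum_component_superset)
  qed (auto intro: diff_in component_in simp: component_outside)
  then show ?thesis by simp
qed

lemma component_zero [simp]: "component 0 i = 0"
  using component_diff[of 0 0 i] by simp

lemma component_add: "component (x + y) i = component x i + component y i"
  using component_diff[of "x + y" y i] by simp

lemma component_sum: "component (sum f F) i = (\<Sum>j\<in>F. component (f j) i)"
  by (induction F rule: infinite_finite_induct) (simp_all add: component_add)

lemma component_homogeneous: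
  assumes "i \<in> I" "x \<in> R i"
  shows "component x j = (if j = i then x else 0)"
proof -
  have "component x = (\<lambda>j. if j = i then x else 0)"
    by (rule component_eqI[where F = "{i}"]) (use assms zero_in in auto)
  then show ?thesis by simp
qed

text \<open>Turns membership in a partial direct sum into vanishing of components, the form in which
  \<open>principal_subring G R\<close> is used from here on.\<close>

lemma mem_finite_sums_iff:
  assumes "J \<subseteq> I"
  shows "x \<in> finite_sums J R \<longleftrightarrow> (\<forall>i. i \<notin> J \<longrightarrow> component x i = 0)"
proof
  assume "x \<in> finite_sums J R"
  then obtain F c where "finite F" "F \<subseteq> J" "\<forall>i\<in>F. c i \<in> R i" "x = (\<Sum>i\<in>F. c i)"
    by (auto simp: finite_sums_def)
  then show "\<forall>i. i \<notin> J \<longrightarrow> component x i = 0"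
    using assms component_homogeneous by (fastforce simp: component_sum intro!: sum.neutral)
next
  assume "\<forall>i. i \<notin> J \<longrightarrow> component x i = 0"
  then show "x \<in> finite_sums J R"
    unfolding finite_sums_def using finite_component[of x] sum_component[of x] component_in assms
    by (intro CollectI exI[of _ "{i. component x i \<noteq> 0}"] exI[of _ "component x"]) blast
qed

end

section \<open>Object unital graded rings and the degrees of products\<close>

locale object_unital_graded_ring =
  morphism_groupoid G + direct_sum "mor G" R for G :: "'g category" and R :: "'g \<Rightarrow> 'r::ring set" +
  assumes graded: "graded_ring G R"
    and object_unital: "object_unital G R"
begin

abbreviation one_syntax ("\<one>") where "\<one> e \<equiv> one_of (R e)"
abbreviation "B \<equiv> principal_subring G R"

lemma mult_in:
  assumes "\<sigma> \<in> M" "\<tau> \<in> M" "d \<sigma> = r \<tau>" "x \<in> R \<sigma>" "y \<in> R \<tau>"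
  shows "x * y \<in> R (\<sigma> \<cdot> \<tau>)"
  using graded assms set_prod_mult[of x "R \<sigma>" y "R \<tau>"]
  unfolding graded_ring_def composable_def by (metis subsetD)

lemma mult_zero:
  assumes "\<sigma> \<in> M" "\<tau> \<in> M" "d \<sigma> \<noteq> r \<tau>" "x \<in> R \<sigma>" "y \<in> R \<tau>"
  shows "x * y = 0"
  using graded assms set_prod_mult[of x "R \<sigma>" y "R \<tau>"]
  unfolding graded_ring_def composable_def by (metis singletonD)

lemma one_in: "e \<in> identities G \<Longrightarrow> \<one> e \<in> R e"
  using object_unital is_one_of_one_of by (auto simp: object_unital_def is_one_of_def)

lemma one_left: "\<sigma> \<in> M \<Longrightarrow> x \<in> R \<sigma> \<Longrightarrow> \<one> (r \<sigma>) * x = x"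
  and one_right: "\<sigma> \<in> M \<Longrightarrow> x \<in> R \<sigma> \<Longrightarrow> x * \<one> (d \<sigma>) = x"
  using object_unital by (auto simp: object_unital_def)

lemma one_left_if:
  assumes "\<sigma> \<in> M" "x \<in> R \<sigma>" "e \<in> identities G"
  shows "\<one> e * x = (if e = r \<sigma> then x else 0)"
  using assms one_left mult_zero[of e \<sigma> "\<one> e" x] one_in by simp

lemma one_right_if:
  assumes "\<sigma> \<in> M" "x \<in> R \<sigma>" "e \<in> identities G"
  shows "x * \<one> e = (if e = d \<sigma> then x else 0)"
  using assms one_right mult_zero[of \<sigma> e x "\<one> e"] one_in by auto

text \<open>Right multiplication by an element of degree \<open>\<tau>\<close> shifts degrees by
  \<open>\<tau>\<close>: a component of degree \<open>i\<close> either is killed or lands in degree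
  \<open>i \<cdot> \<tau>\<close>, which is \<open>\<sigma>\<close> only for
  \<open>i = \<sigma> \<cdot> iv \<tau>\<close>.\<close>

lemma component_mult_right:
  assumes "\<sigma> \<in> M" "\<tau> \<in> M" "b \<in> R \<tau>"
  shows "component (x * b) \<sigma> = (if d \<sigma> = d \<tau> then component x (\<sigma> \<cdot> iv \<tau>) * b else 0)"
proof -
  let ?F = "{i. component x i \<noteq> 0}"
  have "component (component x i * b) \<sigma> =
      (if d \<sigma> = d \<tau> \<and> i = \<sigma> \<cdot> iv \<tau> then component x i * b else 0)" if "i \<in> ?F" for i
  proof -
    have i: "i \<in> M" "component x i \<in> R i"
      using that component_outside component_in by auto
    show ?thesis
    proof (cases "d i = r \<tau>")
      case True
      have "\<sigma> = i \<cdot> \<tau> \<longleftrightarrow> d \<sigma> = d \<tau> \<and> i = \<sigma> \<cdot> iv \<tau>"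
        using True i assms by (auto simp: cmp_cancel_right)
      then show ?thesis
        using component_homogeneous[OF _ mult_in[OF i(1) assms(2) True i(2) assms(3)], of \<sigma>]
          i assms True by simp
    next
      case False
      then show ?thesis using mult_zero[OF i(1) assms(2) False i(2) assms(3)] assms by auto
    qed
  qed
  moreover have "x * b = (\<Sum>i\<in>?F. component x i * b)"
    by (simp flip: sum_distrib_right sum_component)
  ultimately have "component (x * b) \<sigma> =
      (\<Sum>i\<in>?F. if d \<sigma> = d \<tau> \<and> i = \<sigma> \<cdot> iv \<tau> then component x i * b else 0)"
    by (simp add: component_sum)
  then show ?thesis by (auto simp: finite_component)
qed

lemma component_mult_left:
  assumes "\<sigma> \<in> M" "\<tau> \<in> M" "a \<in> R \<tau>"
  shows "component (a * x) \<sigma> = (if r \<sigma> = r \<tau> then a * component x (iv \<tau> \<cdot> \<sigma>) else 0)"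
proof -
  let ?F = "{i. component x i \<noteq> 0}"
  have "component (a * component x i) \<sigma> =
      (if r \<sigma> = r \<tau> \<and> i = iv \<tau> \<cdot> \<sigma> then a * component x i else 0)" if "i \<in> ?F" for i
  proof -
    have i: "i \<in> M" "component x i \<in> R i"
      using that component_outside component_in by auto
    show ?thesis
    proof (cases "d \<tau> = r i")
      case True
      have "\<sigma> = \<tau> \<cdot> i \<longleftrightarrow> r \<sigma> = r \<tau> \<and> i = iv \<tau> \<cdot> \<sigma>"
        using True i assms by (auto simp: cmp_cancel_left)
      then show ?thesis
        using component_homogeneous[OF _ mult_in[OF assms(2) i(1) True assms(3) i(2)], of \<sigma>]
          i assms True by simp
    next
      case False
      then show ?thesis using mult_zero[OF assms(2) i(1) False assms(3) i(2)] assms by auto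
    qed
  qed
  moreover have "a * x = (\<Sum>i\<in>?F. a * component x i)"
    by (simp flip: sum_distrib_left sum_component)
  ultimately have "component (a * x) \<sigma> =
      (\<Sum>i\<in>?F. if r \<sigma> = r \<tau> \<and> i = iv \<tau> \<cdot> \<sigma> then a * component x i else 0)"
    by (simp add: component_sum)
  then show ?thesis by (auto simp: finite_component)
qed

lemma identities_subset: "identities G \<subseteq> M"
  by auto

lemma mem_principal_subring_iff: "b \<in> B \<longleftrightarrow> (\<forall>i. i \<notin> identities G \<longrightarrow> component b i = 0)"
  unfolding principal_subring_def by (rule mem_finite_sums_iff[OF identities_subset])

lemma homogeneous_in_principal_subring: "e \<in> identities G \<Longrightarrow> b \<in> R e \<Longrightarrow> b \<in> B"
  by (auto simp: mem_principal_subring_iff component_homogeneous[of e])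

text \<open>Multiplication by a component at an identity preserves degrees, and only the identity
  \<open>d \<sigma>\<close> can be composed with \<open>\<sigma>\<close> on the right.\<close>

lemma component_mult_principal_right:
  assumes "\<sigma> \<in> M" "b \<in> B"
  shows "component (x * b) \<sigma> = component x \<sigma> * component b (d \<sigma>)"
proof -
  let ?F = "{i. component b i \<noteq> 0}"
  have "component (x * component b i) \<sigma> = (if i = d \<sigma> then component x \<sigma> * component b i else 0)"
    if "i \<in> ?F" for i
  proof -
    have "i \<in> identities G" using that assms by (auto simp: mem_principal_subring_iff)
    then show ?thesis
      using assms component_mult_right[of \<sigma> i "component b i" x] component_in[of i b] by auto
  qed
  moreover have "x * b = (\<Sum>i\<in>?F. x * component b i)"
    by (simp flip: sum_distrib_left sum_component)
  ultimately have "component (x * b) \<sigma> =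
      (\<Sum>i\<in>?F. if i = d \<sigma> then component x \<sigma> * component b i else 0)"
    by (simp add: component_sum)
  then show ?thesis by (auto simp: finite_component)
qed

lemma component_mult_principal_left:
  assumes "\<sigma> \<in> M" "b \<in> B"
  shows "component (b * x) \<sigma> = component b (r \<sigma>) * component x \<sigma>"
proof -
  let ?F = "{i. component b i \<noteq> 0}"
  have "component (component b i * x) \<sigma> = (if i = r \<sigma> then component b i * component x \<sigma> else 0)"
    if "i \<in> ?F" for i
  proof -
    have "i \<in> identities G" using that assms by (auto simp: mem_principal_subring_iff)
    then show ?thesis
      using assms component_mult_left[of \<sigma> i "component b i" x] component_in[of i b] by auto
  qed
  moreover have "b * x = (\<Sum>i\<in>?F. component b i * x)"
    by (simp flip: sum_distrib_right sum_component)
  ultimately have "component (b * x) \<sigma> =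
      (\<Sum>i\<in>?F. if i = r \<sigma> then component b i * component x \<sigma> else 0)"
    by (simp add: component_sum)
  then show ?thesis by (auto simp: finite_component)
qed

lemma is_subring_principal_subring: "is_subring B"
proof -
  have "component (x * y) i = 0" if "x \<in> B" "y \<in> B" "i \<notin> identities G" for x y i
    using that component_mult_principal_right[of i y x] component_outside[of i]
    by (cases "i \<in> M") (auto simp: mem_principal_subring_iff)
  moreover have "component (x - y) i = 0" if "x \<in> B" "y \<in> B" "i \<notin> identities G" for x y i
    using that by (simp add: mem_principal_subring_iff component_diff)
  ultimately show ?thesis
    unfolding is_subring_def is_add_subgroup_def by (auto simp: mem_principal_subring_iff)
qed

section \<open>Homogeneous components of tensors\<close>

text \<open>The map \<open>x \<otimes> y \<mapsto> x\<^sub>\<sigma> y\<^sub>\<tau>\<close> on representatives; it respects tensors only if \<open>d \<sigma> = r \<tau>\<close>.\<close>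

definition tensor_component :: "'g \<Rightarrow> 'g \<Rightarrow> ('r \<times> 'r \<Rightarrow>\<^sub>0 int) \<Rightarrow> 'r" where
  "tensor_component \<sigma> \<tau> w =
    free_mult (frag_extend (\<lambda>(x, y). frag_of (component x \<sigma>, component y \<tau>)) w)"

lemma tensor_component_simps [simp]:
  "tensor_component \<sigma> \<tau> 0 = 0"
  "tensor_component \<sigma> \<tau> (frag_of (x, y)) = component x \<sigma> * component y \<tau>"
  "tensor_component \<sigma> \<tau> (s - t) = tensor_component \<sigma> \<tau> s - tensor_component \<sigma> \<tau> t"
  by (simp_all add: tensor_component_def frag_extend_diff free_mult_diff)

text \<open>The critical relation is the balancing one: \<open>b\<close> contributes its component
  at \<open>d \<sigma>\<close> when it stands on the left and at \<open>r \<tau>\<close> when it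
  stands on the right, and these objects agree.\<close>

lemma tensor_component_cong:
  assumes "tensor_class B s = tensor_class B t" "\<sigma> \<in> M" "\<tau> \<in> M" "d \<sigma> = r \<tau>"
  shows "tensor_component \<sigma> \<tau> s = tensor_component \<sigma> \<tau> t"
proof -
  have "tensor_component \<sigma> \<tau> w = 0" if "w \<in> group_closure (tensor_relators B)" for w
    using that
  proof induction
    case (base w)
    then consider "w = 0" | "w \<in> tensor_relators B" by blast
    then show ?case
    proof cases
      case 2
      then show ?thesis
        by cases (use assms in \<open>simp_all add: component_add distrib_left distrib_right mult.assoc
            component_mult_principal_left component_mult_principal_right\<close>)
    qed simp
  qed simp
  from this[of "s - t"] assms(1) show ?thesis by (simp add: tensor_class_eq_iff)
qed

lemma tensor_component_lmult:
  assumes "\<sigma> \<in> M" "\<tau> \<in> M" "a \<in> R \<tau>" "r \<sigma> = r \<tau>"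
  shows "tensor_component \<sigma> \<rho> (free_lmult a s) = a * tensor_component (iv \<tau> \<cdot> \<sigma>) \<rho> s"
proof (induction s rule: frag_induct)
  case (one p)
  then show ?case by (cases p) (simp add: assms component_mult_left[OF assms(1-3)] mult.assoc)
qed (simp_all add: free_lmult_diff right_diff_distrib)

lemma tensor_component_rmult:
  assumes "\<rho> \<in> M" "\<tau> \<in> M" "a \<in> R \<tau>" "d \<rho> = d \<tau>"
  shows "tensor_component \<sigma> \<rho> (free_rmult s a) = tensor_component \<sigma> (\<rho> \<cdot> iv \<tau>) s * a"
proof (induction s rule: frag_induct)
  case (one p)
  then show ?case by (cases p) (simp add: assms component_mult_right[OF assms(1-3)] mult.assoc)
qed (simp_all add: free_rmult_diff left_diff_distrib)

lemma tensor_component_in: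
  assumes "\<sigma> \<in> M"
  shows "tensor_component \<sigma> (iv \<sigma>) s \<in> R (r \<sigma>)"
proof (induction s rule: frag_induct)
  case zero
  show ?case using assms by (simp add: zero_in)
next
  case (one p)
  show ?case
    using mult_in[OF assms, of "iv \<sigma>" "component (fst p) \<sigma>" "component (snd p) (iv \<sigma>)"] assms
    by (cases p) (simp add: component_in)
next
  case (diff s t)
  then show ?case using assms by (simp add: diff_in)
qed

text \<open>In a product \<open>x * y\<close> only pairs of degrees \<open>\<sigma>\<close> and
  \<open>iv \<sigma>\<close> with \<open>r \<sigma> = e\<close> reach degree \<open>e\<close>.
  \<open>F\<close> need not be the exact support; it can be enlarged by zero terms, which makes the
  union work for differences.\<close>

lemma tensor_component_sum:
  assumes e: "e \<in> identities G"
  shows "\<exists>F. finite F \<and> F \<subseteq> {\<sigma> \<in> M. r \<sigma> = e} \<and>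
    (\<forall>\<sigma>\<in>{\<sigma> \<in> M. r \<sigma> = e} - F. tensor_component \<sigma> (iv \<sigma>) s = 0) \<and>
    (\<Sum>\<sigma>\<in>F. tensor_component \<sigma> (iv \<sigma>) s) = component (free_mult s) e"
proof (induction s rule: frag_induct)
  case zero
  show ?case by (rule exI[of _ "{}"]) simp
next
  case (one p)
  obtain x y where p: "p = (x, y)" by fastforce
  let ?S = "{\<sigma>. component x \<sigma> \<noteq> 0}" and ?F = "{\<sigma> \<in> M. r \<sigma> = e \<and> component x \<sigma> \<noteq> 0}"
  have S: "?S \<subseteq> M" using component_outside by auto
  have "x * y = (\<Sum>\<sigma>\<in>?S. component x \<sigma> * y)"
    by (simp flip: sum_distrib_right sum_component)
  then have "component (x * y) e = (\<Sum>\<sigma>\<in>?S. component (component x \<sigma> * y) e)"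
    by (simp add: component_sum)
  also have "\<dots> = (\<Sum>\<sigma>\<in>?S. if r \<sigma> = e then component x \<sigma> * component y (iv \<sigma>) else 0)"
  proof (rule sum.cong[OF refl])
    fix \<sigma> assume "\<sigma> \<in> ?S"
    then have s: "\<sigma> \<in> M" using S by blast
    have "iv \<sigma> \<cdot> r \<sigma> = iv \<sigma>" using d_r_simps(7)[of "iv \<sigma>"] s by simp
    then show "component (component x \<sigma> * y) e =
        (if r \<sigma> = e then component x \<sigma> * component y (iv \<sigma>) else 0)"
      using component_mult_left[of e \<sigma> "component x \<sigma>" y] s e component_in by auto
  qed
  also have "\<dots> = (\<Sum>\<sigma>\<in>?F. component x \<sigma> * component y (iv \<sigma>))"
    using S finite_component[of x] by (intro sum.mono_neutral_cong_right) auto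
  finally show ?case
    using finite_subset[OF _ finite_component[of x], of ?F]
    by (intro exI[of _ ?F]) (auto simp: p)
next
  case (diff s t)
  from diff(1) obtain F where F: "finite F" "F \<subseteq> {\<sigma> \<in> M. r \<sigma> = e}"
    "\<forall>\<sigma>\<in>{\<sigma> \<in> M. r \<sigma> = e} - F. tensor_component \<sigma> (iv \<sigma>) s = 0"
    "(\<Sum>\<sigma>\<in>F. tensor_component \<sigma> (iv \<sigma>) s) = component (free_mult s) e"
    by blast
  from diff(2) obtain F' where F': "finite F'" "F' \<subseteq> {\<sigma> \<in> M. r \<sigma> = e}"
    "\<forall>\<sigma>\<in>{\<sigma> \<in> M. r \<sigma> = e} - F'. tensor_component \<sigma> (iv \<sigma>) t = 0"
    "(\<Sum>\<sigma>\<in>F'. tensor_component \<sigma> (iv \<sigma>) t) = component (free_mult t) e"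
    by blast
  have "(\<Sum>\<sigma>\<in>F \<union> F'. tensor_component \<sigma> (iv \<sigma>) s) = (\<Sum>\<sigma>\<in>F. tensor_component \<sigma> (iv \<sigma>) s)"
    "(\<Sum>\<sigma>\<in>F \<union> F'. tensor_component \<sigma> (iv \<sigma>) t) = (\<Sum>\<sigma>\<in>F'. tensor_component \<sigma> (iv \<sigma>) t)"
    using F F' by (intro sum.mono_neutral_right; auto)+
  then show ?case
    using F F' by (intro exI[of _ "F \<union> F'"])
      (auto simp: sum_subtractf free_mult_diff component_diff)
qed

end

section \<open>Separability and the trace\<close>

lemma gam_sum: "gam n u v \<sigma> (sum f F) = (\<Sum>j\<in>F. gam n u v \<sigma> (f j))"
  unfolding gam_def by (simp add: sum_distrib_left sum_distrib_right) (rule sum.swap)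

section \<open>From a bimodule section to elements of trace one\<close>

locale graded_ring_with_trace = object_unital_graded_ring +
  fixes n u v
  assumes trace_choice: "trace_choice G R n u v"
begin

lemma u_in: "\<sigma> \<in> M \<Longrightarrow> i \<in> {1..n \<sigma>} \<Longrightarrow> u \<sigma> i \<in> R \<sigma>"
  and v_in: "\<sigma> \<in> M \<Longrightarrow> i \<in> {1..n \<sigma>} \<Longrightarrow> v \<sigma> i \<in> R (iv \<sigma>)"
  and sum_u_v: "\<sigma> \<in> M \<Longrightarrow> (\<Sum>i=1..n \<sigma>. u \<sigma> i * v \<sigma> i) = \<one> (r \<sigma>)"
  using trace_choice by (auto simp: trace_choice_def)

lemma trace_if_separable:
  assumes "separable_extension B" "e \<in> identities G" "\<one> e \<noteq> 0"
  shows "finite (isotropy G e) \<and> \<one> e \<in> trace_at G n u v e ` ring_center (R e)"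
proof -
  obtain \<delta> where \<delta>: "is_bimodule_section B \<delta>"
    using assms(1) by (auto simp: separable_extension_def)
  then have "\<exists>s. \<delta> a = tensor_class B s" for a
    unfolding is_bimodule_section_def by (metis tensor_square_cases)
  then obtain S where S: "\<And>a. \<delta> a = tensor_class B (S a)" by metis
  define t where "t f = S (\<one> f)" for f
  define c where "c \<sigma> = tensor_component \<sigma> (iv \<sigma>) (t (r \<sigma>))" for \<sigma>
  \<comment> \<open>Both sides are \<open>\<delta> a\<close>, computed once from
    \<open>a = a * \<one> (d \<tau>)\<close> and once from
    \<open>a = \<one> (r \<tau>) * a\<close>.\<close>
  have t_comm: "tensor_class B (free_lmult a (t (d \<tau>))) = tensor_class B (free_rmult (t (r \<tau>)) a)"
    if "\<tau> \<in> M" "a \<in> R \<tau>" for \<tau> a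
  proof -
    have "\<delta> (a * \<one> (d \<tau>)) = tensor_lmult B a (\<delta> (\<one> (d \<tau>)))"
      "\<delta> (\<one> (r \<tau>) * a) = tensor_rmult B (\<delta> (\<one> (r \<tau>))) a"
      using \<delta> unfolding is_bimodule_section_def by blast+
    then show ?thesis
      using that by (simp add: one_left one_right S tensor_lmult_class tensor_rmult_class t_def)
  qed
  have mult_t: "free_mult (t f) = \<one> f" for f
    using \<delta> S tensor_mult_class[of "\<delta> (\<one> f)" B "S (\<one> f)"]
    unfolding is_bimodule_section_def t_def by metis
  have c_in: "c \<sigma> \<in> R (r \<sigma>)" if "\<sigma> \<in> M" for \<sigma>
    unfolding c_def using that by (rule tensor_component_in)
  \<comment> \<open>Take the component at the pair \<open>\<tau> \<cdot> \<sigma>\<close>,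
    \<open>iv \<sigma>\<close> in \<open>t_comm\<close>. The pair is composable, so this respects
    classes. The factor \<open>a\<close> shifts the left degree back to \<open>\<sigma>\<close> on
    one side and the right degree to \<open>iv (\<tau> \<cdot> \<sigma>)\<close> on the
    other.\<close>
  have c_comm: "a * c \<sigma> = c (\<tau> \<cdot> \<sigma>) * a"
    if "\<tau> \<in> M" "\<sigma> \<in> M" "d \<tau> = r \<sigma>" "a \<in> R \<tau>" for \<tau> \<sigma> a
  proof -
    have "tensor_component (\<tau> \<cdot> \<sigma>) (iv \<sigma>) (free_lmult a (t (d \<tau>))) =
        tensor_component (\<tau> \<cdot> \<sigma>) (iv \<sigma>) (free_rmult (t (r \<tau>)) a)"
      using that by (intro tensor_component_cong t_comm) simp_all
    moreover have "tensor_component (\<tau> \<cdot> \<sigma>) (iv \<sigma>) (free_lmult a (t (d \<tau>))) = a * c \<sigma>"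
      using that by (subst tensor_component_lmult[of _ \<tau>]) (simp_all add: cmp_cancel_left c_def)
    moreover have "tensor_component (\<tau> \<cdot> \<sigma>) (iv \<sigma>) (free_rmult (t (r \<tau>)) a) = c (\<tau> \<cdot> \<sigma>) * a"
      using that by (subst tensor_component_rmult[of _ \<tau>]) (simp_all add: inv_cmp c_def)
    ultimately show ?thesis by simp
  qed
  \<comment> \<open>This is \<open>c_comm\<close> for the identity
    \<open>\<tau> = r \<sigma>\<close>, where
    \<open>\<tau> \<cdot> \<sigma> = \<sigma>\<close>.\<close>
  have c_center: "c \<sigma> \<in> ring_center (R (r \<sigma>))" if "\<sigma> \<in> M" for \<sigma>
    using c_in[OF that] c_comm[of "r \<sigma>" \<sigma>] that by (simp add: ring_center_def)
  have gam_c: "gam n u v \<tau> (c \<sigma>) = c (\<tau> \<cdot> \<sigma>)" if "\<tau> \<in> M" "\<sigma> \<in> M" "d \<tau> = r \<sigma>" for \<tau> \<sigma>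
  proof -
    have "gam n u v \<tau> (c \<sigma>) = (\<Sum>i=1..n \<tau>. c (\<tau> \<cdot> \<sigma>) * (u \<tau> i * v \<tau> i))"
      unfolding gam_def using that by (simp add: c_comm u_in mult.assoc)
    also have "\<dots> = c (\<tau> \<cdot> \<sigma>) * \<one> (r \<tau>)"
      using that sum_u_v[of \<tau>] by (simp flip: sum_distrib_left)
    also have "\<dots> = c (\<tau> \<cdot> \<sigma>)"
      using that one_right[of "r \<tau>" "c (\<tau> \<cdot> \<sigma>)"] c_in[of "\<tau> \<cdot> \<sigma>"] by simp
    finally show ?thesis .
  qed
  obtain F where F: "finite F" "F \<subseteq> {\<sigma> \<in> M. r \<sigma> = e}"
    "\<And>\<sigma>. \<sigma> \<in> M \<Longrightarrow> r \<sigma> = e \<Longrightarrow> \<sigma> \<notin> F \<Longrightarrow> c \<sigma> = 0" "(\<Sum>\<sigma>\<in>F. c \<sigma>) = \<one> e"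
  proof -
    obtain F where F: "finite F" "F \<subseteq> {\<sigma> \<in> M. r \<sigma> = e}"
      "\<forall>\<sigma>\<in>{\<sigma> \<in> M. r \<sigma> = e} - F. tensor_component \<sigma> (iv \<sigma>) (t e) = 0"
      "(\<Sum>\<sigma>\<in>F. tensor_component \<sigma> (iv \<sigma>) (t e)) = component (free_mult (t e)) e"
      using tensor_component_sum[OF assms(2), of "t e"] by blast
    have "(\<Sum>\<sigma>\<in>F. c \<sigma>) = (\<Sum>\<sigma>\<in>F. tensor_component \<sigma> (iv \<sigma>) (t e))"
      using F(2) by (intro sum.cong) (auto simp: c_def)
    then have "(\<Sum>\<sigma>\<in>F. c \<sigma>) = \<one> e"
      using F(4) assms(2) component_homogeneous[of e "\<one> e" e] by (simp add: mult_t one_in)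
    with F(1-3) that show thesis by (auto simp: c_def)
  qed
  have fin_iso: "finite (isotropy G e)"
  proof -
    obtain \<sigma> where \<sigma>: "\<sigma> \<in> F" "c \<sigma> \<noteq> 0"
      using F(4) assms(3) sum.neutral[of F c] by metis
    have s: "\<sigma> \<in> M" "r \<sigma> = e" using \<sigma> F by auto
    \<comment> \<open>The orbit of \<open>\<sigma>\<close> stays in \<open>F\<close>: if
      \<open>c\<close> vanished at \<open>\<tau> \<cdot> \<sigma>\<close>, then applying
      \<open>gam\<close> at \<open>iv \<tau>\<close> would give
      \<open>c \<sigma> = 0\<close>.\<close>
    have "\<tau> \<cdot> \<sigma> \<in> F" if "\<tau> \<in> hom e e" for \<tau>
    proof (rule ccontr)
      have t: "\<tau> \<in> M" "d \<tau> = e" "r \<tau> = e" using that by (auto simp: hom_def)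
      assume "\<tau> \<cdot> \<sigma> \<notin> F"
      then have "c (\<tau> \<cdot> \<sigma>) = 0" using F(3) s t by simp
      then have "c \<sigma> = gam n u v (iv \<tau>) 0"
        using gam_c[of "iv \<tau>" "\<tau> \<cdot> \<sigma>"] s t by (simp add: cmp_cancel_left)
      then show False using \<sigma> by (simp add: gam_def)
    qed
    moreover have "bij_betw (\<lambda>\<tau>. \<tau> \<cdot> \<sigma>) (hom e e) (hom (d \<sigma>) e)"
      using bij_betw_cmp_right[OF s(1), of e] s by simp
    ultimately show ?thesis
      unfolding isotropy_eq_hom using F(1) by (metis bij_betw_def finite_imageD finite_subset image_subsetI)
  qed
  \<comment> \<open>Under left multiplication by the isotropy group, the orbits on the morphisms
    into \<open>e\<close> are the sets \<open>hom f e\<close>. Hence \<open>g\<close> chooses one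
    representative in \<open>F\<close> for each orbit that meets \<open>F\<close>.\<close>
  define g where "g = inv_into F d"
  have g: "g f \<in> F \<and> d (g f) = f" if "f \<in> d ` F" for f
    using that by (simp add: g_def inv_into_into f_inv_into_f)
  define z where "z = (\<Sum>f\<in>d ` F. c (g f))"
  have g': "g f \<in> M" "r (g f) = e" "d (g f) = f" if "f \<in> d ` F" for f
    using g[OF that] F(2) by auto
  have z_center: "z \<in> ring_center (R e)"
  proof -
    have c: "c (g f) \<in> ring_center (R e)" if "f \<in> d ` F" for f
      using c_center[of "g f"] g'[OF that] by simp
    then have "z \<in> R e"
      unfolding z_def using assms(2) by (intro sum_in) (auto simp: ring_center_def)
    moreover have "z * x = x * z" if "x \<in> R e" for x
      unfolding z_def sum_distrib_left sum_distrib_right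
      using c that by (intro sum.cong) (auto simp: ring_center_def)
    ultimately show ?thesis by (simp add: ring_center_def)
  qed
  have trace_z: "trace_at G n u v e z = \<one> e"
  proof -
    have fin: "finite (hom f e)" if "f \<in> d ` F" for f
    proof -
      have "bij_betw (\<lambda>\<tau>. \<tau> \<cdot> g f) (hom e e) (hom f e)"
        using bij_betw_cmp_right[of "g f" e] g'[OF that] by simp
      then show ?thesis
        using fin_iso by (simp add: isotropy_eq_hom bij_betw_finite)
    qed
    have "trace_at G n u v e z = (\<Sum>\<tau>\<in>hom e e. \<Sum>f\<in>d ` F. gam n u v \<tau> (c (g f)))"
      by (simp add: trace_at_def z_def gam_sum isotropy_eq_hom)
    also have "\<dots> = (\<Sum>f\<in>d ` F. \<Sum>\<tau>\<in>hom e e. gam n u v \<tau> (c (g f)))"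
      by (rule sum.swap)
    also have "\<dots> = (\<Sum>f\<in>d ` F. \<Sum>\<sigma>\<in>hom f e. c \<sigma>)"
    proof (rule sum.cong[OF refl])
      fix f assume f: "f \<in> d ` F"
      have "(\<Sum>\<tau>\<in>hom e e. gam n u v \<tau> (c (g f))) = (\<Sum>\<tau>\<in>hom e e. c (\<tau> \<cdot> g f))"
        using g'[OF f] by (intro sum.cong) (auto simp: hom_def gam_c)
      also have "\<dots> = (\<Sum>\<sigma>\<in>hom f e. c \<sigma>)"
        using bij_betw_cmp_right[of "g f" e] g'[OF f] by (intro sum.reindex_bij_betw) simp
      finally show "(\<Sum>\<tau>\<in>hom e e. gam n u v \<tau> (c (g f))) = (\<Sum>\<sigma>\<in>hom f e. c \<sigma>)" .
    qed
    also have "\<dots> = (\<Sum>\<sigma>\<in>(\<Union>f\<in>d ` F. hom f e). c \<sigma>)"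
      using F(1) fin by (intro sum.UNION_disjoint[symmetric]) (auto simp: hom_def)
    \<comment> \<open>Whole orbits may exceed \<open>F\<close>, but \<open>c\<close> is zero at the
      additional morphisms.\<close>
    also have "\<dots> = (\<Sum>\<sigma>\<in>F. c \<sigma>)"
    proof (rule sum.mono_neutral_right)
      show "finite (\<Union>f\<in>d ` F. hom f e)" using F(1) fin by blast
      show "F \<subseteq> (\<Union>f\<in>d ` F. hom f e)" using F(2) by (auto simp: hom_def)
      show "\<forall>\<sigma>\<in>(\<Union>f\<in>d ` F. hom f e) - F. c \<sigma> = 0" using F(3) by (auto simp: hom_def)
    qed
    finally show ?thesis using F(4) by simp
  qed
  show ?thesis using fin_iso imageI[OF z_center, of "trace_at G n u v e"] trace_z by simp
qed

end

section \<open>From commuting families to bimodule sections\<close>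

context object_unital_graded_ring
begin

text \<open>Sources and targets are both recorded, so that the units at these finitely many objects
  fix \<open>a\<close> from either side.\<close>

definition objects :: "'r \<Rightarrow> 'g set" where
  "objects a = d ` {i. component a i \<noteq> 0} \<union> r ` {i. component a i \<noteq> 0}"

lemma objects: "finite (objects a)" "objects a \<subseteq> identities G"
proof -
  show "finite (objects a)" using finite_component[of a] by (simp add: objects_def)
  have "{i. component a i \<noteq> 0} \<subseteq> M" using component_outside by auto
  then show "objects a \<subseteq> identities G" by (auto simp: objects_def)
qed

lemma mult_one_eq_zero:
  assumes "e \<in> identities G" "e \<notin> objects a"
  shows "a * \<one> e = 0"
proof -
  have "a * \<one> e = (\<Sum>i | component a i \<noteq> 0. component a i * \<one> e)"
    by (simp flip: sum_distrib_right sum_component)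
  also have "\<dots> = 0"
  proof (rule sum.neutral, rule ballI)
    fix i assume i: "i \<in> {i. component a i \<noteq> 0}"
    then have "i \<in> M" "e \<noteq> d i" using component_outside assms by (auto simp: objects_def)
    then show "component a i * \<one> e = 0" using one_right_if[of i "component a i" e] assms component_in by simp
  qed
  finally show ?thesis .
qed

lemma sum_mult_one:
  assumes "finite F" "objects a \<subseteq> F" "F \<subseteq> identities G"
  shows "(\<Sum>e\<in>F. a * \<one> e) = a"
proof -
  have "(\<Sum>e\<in>F. component a i * \<one> e) = component a i" if "component a i \<noteq> 0" for i
  proof -
    have i: "i \<in> M" "d i \<in> F" using that component_outside assms(2) by (auto simp: objects_def)
    then have "(\<Sum>e\<in>F. component a i * \<one> e) = (\<Sum>e\<in>F. if e = d i then component a i else 0)"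
      using one_right_if[of i "component a i"] component_in assms(3) by (intro sum.cong) auto
    with i assms(1) show ?thesis by simp
  qed
  then have "a = (\<Sum>i | component a i \<noteq> 0. \<Sum>e\<in>F. component a i * \<one> e)"
    using sum_component[of a] by simp
  also have "\<dots> = (\<Sum>e\<in>F. (\<Sum>i | component a i \<noteq> 0. component a i) * \<one> e)"
    unfolding sum_distrib_right by (rule sum.swap)
  finally show ?thesis by (simp flip: sum_component)
qed

text \<open>
  The elements \<open>T e\<close> play the role of \<open>\<delta> 1\<close>: although the ring need not be unital, each
  \<open>a\<close> is fixed by a finite sum of units \<open>\<one> e\<close>.
\<close>

lemma separable_if_commuting_family:
  assumes T_left: "\<And>e. e \<in> identities G \<Longrightarrow> free_lmult (\<one> e) (T e) = T e"
    and T_right: "\<And>e. e \<in> identities G \<Longrightarrow> free_rmult (T e) (\<one> e) = T e"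
    and T_mult: "\<And>e. e \<in> identities G \<Longrightarrow> free_mult (T e) = \<one> e"
    and T_comm: "\<And>\<tau> a. \<tau> \<in> M \<Longrightarrow> a \<in> R \<tau> \<Longrightarrow>
      tensor_class B (free_lmult a (T (d \<tau>))) = tensor_class B (free_rmult (T (r \<tau>)) a)"
  shows "separable_extension B"
proof -
  \<comment> \<open>Formally this is \<open>a\<close> times the sum of the \<open>T e\<close> over
    \<open>F\<close>. It represents \<open>\<delta> a\<close> as soon as \<open>F\<close> contains
    \<open>objects a\<close>.\<close>
  define D where "D F a = (\<Sum>e\<in>F. free_lmult a (T e))" for F a
  define \<delta> where "\<delta> a = tensor_class B (D (objects a) a)" for a
  \<comment> \<open>\<open>T_left\<close> is an equality of representatives, so \<open>a\<close> may
    be replaced by \<open>a * \<one> e\<close>. A zero scalar then gives zero, though only as a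
    class.\<close>
  have lmult_T: "tensor_class B (free_lmult a (T e)) = tensor_class B 0"
    if "e \<in> identities G" "a * \<one> e = 0" for a e
  proof -
    have "free_lmult a (T e) = free_lmult (a * \<one> e) (T e)"
      using T_left[OF that(1)] free_lmult_lmult[of a "\<one> e" "T e"] by simp
    then show ?thesis using that by simp
  qed
  have rmult_T: "tensor_class B (free_rmult (T e) a) = tensor_class B 0"
    if "e \<in> identities G" "\<one> e * a = 0" for a e
  proof -
    have "free_rmult (T e) a = free_rmult (T e) (\<one> e * a)"
      using T_right[OF that(1)] free_rmult_rmult[of "T e" "\<one> e" a] by simp
    then show ?thesis using that by simp
  qed
  have \<delta>_eq: "\<delta> a = tensor_class B (D F a)"
    if "finite F" "objects a \<subseteq> F" "F \<subseteq> identities G" for F a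
  proof -
    have "tensor_class B (D F a) =
        tensor_class B (\<Sum>e\<in>F. if e \<in> objects a then free_lmult a (T e) else 0)"
      unfolding D_def using that by (intro tensor_class_sum_cong) (auto simp: lmult_T mult_one_eq_zero subset_iff)
    also have "(\<Sum>e\<in>F. if e \<in> objects a then free_lmult a (T e) else 0) = D (objects a) a"
      unfolding D_def using that by (intro sum.mono_neutral_cong_right) auto
    finally show ?thesis by (simp add: \<delta>_def)
  qed
  \<comment> \<open>Split \<open>a\<close> into components. From the right, the component of degree
    \<open>i\<close> meets only \<open>T (r i)\<close>; \<open>T_comm\<close> turns this into its
    left action on \<open>T (d i)\<close>, and the vanishing terms are then put back.\<close>
  have D_comm: "tensor_class B (\<Sum>e\<in>F. free_rmult (T e) a) = tensor_class B (D F a)"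
    if F: "finite F" "objects a \<subseteq> F" "F \<subseteq> identities G" for F a
  proof -
    let ?S = "{i. component a i \<noteq> 0}"
    have S: "i \<in> M" "component a i \<in> R i" "d i \<in> F" "r i \<in> F" if "i \<in> ?S" for i
      using that component_outside[of i] component_in[of i] F(2) by (auto simp: objects_def)
    have one: "\<one> e * component a i = (if e = r i then component a i else 0)"
      "component a i * \<one> e = (if e = d i then component a i else 0)" if "i \<in> ?S" "e \<in> F" for i e
      using S(1,2)[OF that(1)] that(2) F(3) by (intro one_left_if one_right_if; blast)+
    have sum: "(\<Sum>i\<in>?S. component a i) = a" by (simp flip: sum_component)
    have "tensor_class B (\<Sum>e\<in>F. free_rmult (T e) a) =
        tensor_class B (\<Sum>e\<in>F. \<Sum>i\<in>?S. free_rmult (T e) (component a i))"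
      by (intro tensor_class_sum_cong) (simp only: sum tensor_class_rmult_sum[symmetric])
    also have "(\<Sum>e\<in>F. \<Sum>i\<in>?S. free_rmult (T e) (component a i)) =
        (\<Sum>i\<in>?S. \<Sum>e\<in>F. free_rmult (T e) (component a i))"
      by (rule sum.swap)
    also have "tensor_class B \<dots> =
        tensor_class B (\<Sum>i\<in>?S. \<Sum>e\<in>F. if e = r i then free_rmult (T e) (component a i) else 0)"
      using S F(3) by (intro tensor_class_sum_cong) (auto simp: one subset_iff intro!: rmult_T)
    also have "(\<Sum>i\<in>?S. \<Sum>e\<in>F. if e = r i then free_rmult (T e) (component a i) else 0) =
        (\<Sum>i\<in>?S. free_rmult (T (r i)) (component a i))"
      using S F(1) by (intro sum.cong) simp_all
    also have "tensor_class B \<dots> = tensor_class B (\<Sum>i\<in>?S. free_lmult (component a i) (T (d i)))"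
      using S by (intro tensor_class_sum_cong T_comm[symmetric]) auto
    also have "(\<Sum>i\<in>?S. free_lmult (component a i) (T (d i))) =
        (\<Sum>i\<in>?S. \<Sum>e\<in>F. if e = d i then free_lmult (component a i) (T e) else 0)"
      using S F(1) by (intro sum.cong) simp_all
    also have "tensor_class B \<dots> = tensor_class B (\<Sum>i\<in>?S. \<Sum>e\<in>F. free_lmult (component a i) (T e))"
      using S F(3) by (intro tensor_class_sum_cong) (auto simp: one subset_iff intro!: lmult_T[symmetric])
    also have "(\<Sum>i\<in>?S. \<Sum>e\<in>F. free_lmult (component a i) (T e)) =
        (\<Sum>e\<in>F. \<Sum>i\<in>?S. free_lmult (component a i) (T e))"
      by (rule sum.swap)
    also have "tensor_class B \<dots> = tensor_class B (D F a)"
      unfolding D_def by (intro tensor_class_sum_cong) (simp only: sum tensor_class_lmult_sum[symmetric])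
    finally show ?thesis .
  qed
  have lmult_D: "free_lmult a (D F a') = D F (a * a')" for F a a'
    by (simp add: D_def free_lmult_sum free_lmult_lmult)
  have "is_bimodule_section B \<delta>"
    unfolding is_bimodule_section_def
  proof (intro conjI allI)
    fix a a'
    show "\<delta> a \<in> tensor_square B" by (simp add: \<delta>_def tensor_class_in_square)
    show "tensor_mult (\<delta> a) = a"
    proof -
      have "tensor_mult (\<delta> a) = (\<Sum>e\<in>objects a. free_mult (free_lmult a (T e)))"
        unfolding \<delta>_def D_def free_mult_sum[symmetric] by (rule tensor_mult_class) simp
      also have "\<dots> = (\<Sum>e\<in>objects a. a * \<one> e)"
        using objects(2)[of a] T_mult by (intro sum.cong) (auto simp: free_mult_lmult)
      also have "\<dots> = a" by (simp add: sum_mult_one objects)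
      finally show ?thesis .
    qed
    \<comment> \<open>One finite set large enough for all four values of \<open>\<delta>\<close>, so
      that their representatives are sums over the same index set.\<close>
    let ?F = "objects a \<union> objects a' \<union> objects (a + a') \<union> objects (a * a')"
    have F: "finite ?F" "?F \<subseteq> identities G" by (simp_all add: objects)
    have \<delta>: "\<delta> a = tensor_class B (D ?F a)" "\<delta> a' = tensor_class B (D ?F a')"
      "\<delta> (a + a') = tensor_class B (D ?F (a + a'))" "\<delta> (a * a') = tensor_class B (D ?F (a * a'))"
      by (rule \<delta>_eq; use F in blast)+
    have "tensor_class B (D ?F (a + a')) = tensor_class B (D ?F a + D ?F a')"
      unfolding D_def sum.distrib[symmetric] by (intro tensor_class_sum_cong tensor_class_lmult_add)
    then show "\<delta> (a + a') = tensor_add B (\<delta> a) (\<delta> a')"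
      by (simp add: \<delta> tensor_add_class)
    show "\<delta> (a * a') = tensor_lmult B a (\<delta> a')"
      by (simp add: \<delta> tensor_lmult_class lmult_D)
    \<comment> \<open>The two outer actions commute, so \<open>a\<close> is pulled out,
      \<open>D_comm\<close> moves \<open>a'\<close> to the left side, and \<open>lmult_D\<close>
      merges the two scalars.\<close>
    have "free_rmult (D ?F a) a' = free_lmult a (\<Sum>e\<in>?F. free_rmult (T e) a')"
      by (simp add: D_def free_lmult_sum free_rmult_sum free_lmult_rmult)
    also have "tensor_class B \<dots> = tensor_class B (free_lmult a (D ?F a'))"
      by (intro tensor_class_lmult_cong D_comm) (use F in auto)
    finally show "\<delta> (a * a') = tensor_rmult B (\<delta> a) a'"
      by (simp add: \<delta> tensor_rmult_class lmult_D)
  qed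
  then show ?thesis
    using is_subring_principal_subring by (auto simp: separable_extension_def)
qed

end

section \<open>From elements of trace one to commuting families\<close>

context graded_ring_with_trace
begin

text \<open>A dual basis argument: one matrix \<open>?b\<close> over \<open>R (d \<sigma>)\<close>
  expands \<open>a * u \<sigma> i\<close> in the elements \<open>u ?\<rho> j\<close> and also
  \<open>v ?\<rho> j * a\<close> in the elements \<open>v \<sigma> i\<close>. Its entries commute
  with \<open>z\<close> and lie in \<open>B\<close>, so they can be moved across the tensor
  sign.\<close>

lemma dual_basis_comm:
  assumes "\<tau> \<in> M" "\<sigma> \<in> M" "d \<tau> = r \<sigma>" "a \<in> R \<tau>" "z \<in> ring_center (R (d \<sigma>))"
  shows "tensor_class B (\<Sum>i=1..n \<sigma>. frag_of (a * (u \<sigma> i * z), v \<sigma> i)) =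
    tensor_class B (\<Sum>j=1..n (\<tau> \<cdot> \<sigma>). frag_of (u (\<tau> \<cdot> \<sigma>) j * z, v (\<tau> \<cdot> \<sigma>) j * a))"
proof -
  let ?\<rho> = "\<tau> \<cdot> \<sigma>"
  let ?b = "\<lambda>i j. v ?\<rho> j * a * u \<sigma> i"
  have \<rho>: "?\<rho> \<in> M" using assms by simp
  have b: "?b i j \<in> R (d \<sigma>)" if "i \<in> {1..n \<sigma>}" "j \<in> {1..n ?\<rho>}" for i j
  proof -
    have "v ?\<rho> j * (a * u \<sigma> i) \<in> R (iv ?\<rho> \<cdot> ?\<rho>)"
      using that assms by (intro mult_in v_in u_in) auto
    then show ?thesis using assms by (simp add: mult.assoc)
  qed
  have left: "tensor_class B (frag_of (a * (u \<sigma> i * z), v \<sigma> i)) =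
      tensor_class B (\<Sum>j=1..n ?\<rho>. frag_of (u ?\<rho> j * z, ?b i j * v \<sigma> i))"
    if i: "i \<in> {1..n \<sigma>}" for i
  proof -
    have "a * u \<sigma> i \<in> R ?\<rho>" using i assms by (intro mult_in u_in) auto
    then have "a * u \<sigma> i = \<one> (r ?\<rho>) * (a * u \<sigma> i)" using one_left \<rho> by simp
    also have "\<dots> = (\<Sum>j=1..n ?\<rho>. u ?\<rho> j * ?b i j)"
      unfolding sum_u_v[OF \<rho>, symmetric] sum_distrib_right by (simp add: mult.assoc)
    finally have "a * (u \<sigma> i * z) = (\<Sum>j=1..n ?\<rho>. u ?\<rho> j * ?b i j) * z"
      by (simp add: mult.assoc)
    \<comment> \<open>Centrality of \<open>z\<close> puts the matrix entry last in the left factor,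
      where the balancing relation applies.\<close>
    also have "\<dots> = (\<Sum>j=1..n ?\<rho>. u ?\<rho> j * z * ?b i j)"
      unfolding sum_distrib_right
    proof (rule sum.cong[OF refl])
      fix j assume "j \<in> {1..n ?\<rho>}"
      then have "z * ?b i j = ?b i j * z" using b[OF i] assms(5) by (simp add: ring_center_def)
      then show "u ?\<rho> j * ?b i j * z = u ?\<rho> j * z * ?b i j" by (simp add: mult.assoc)
    qed
    finally have "tensor_class B (frag_of (a * (u \<sigma> i * z), v \<sigma> i)) =
        tensor_class B (\<Sum>j=1..n ?\<rho>. frag_of (u ?\<rho> j * z * ?b i j, v \<sigma> i))"
      by (simp only: tensor_class_frag_sum_left)
    also have "\<dots> = tensor_class B (\<Sum>j=1..n ?\<rho>. frag_of (u ?\<rho> j * z, ?b i j * v \<sigma> i))"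
      using b[OF i] assms(2)
      by (intro tensor_class_sum_cong tensor_class_frag_balanced homogeneous_in_principal_subring) auto
    finally show ?thesis .
  qed
  have right: "tensor_class B (\<Sum>i=1..n \<sigma>. frag_of (u ?\<rho> j * z, ?b i j * v \<sigma> i)) =
      tensor_class B (frag_of (u ?\<rho> j * z, v ?\<rho> j * a))" for j
  proof -
    have "(\<Sum>i=1..n \<sigma>. ?b i j * v \<sigma> i) = v ?\<rho> j * (a * (\<Sum>i=1..n \<sigma>. u \<sigma> i * v \<sigma> i))"
      by (simp add: mult.assoc sum_distrib_left)
    also have "\<dots> = v ?\<rho> j * a"
      using sum_u_v[OF assms(2)] one_right[OF assms(1,4)] assms(3) by simp
    finally show ?thesis by (simp only: tensor_class_frag_sum_right[symmetric])
  qed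
  have "tensor_class B (\<Sum>i=1..n \<sigma>. frag_of (a * (u \<sigma> i * z), v \<sigma> i)) =
      tensor_class B (\<Sum>i=1..n \<sigma>. \<Sum>j=1..n ?\<rho>. frag_of (u ?\<rho> j * z, ?b i j * v \<sigma> i))"
    by (rule tensor_class_sum_cong[OF left])
  also have "(\<Sum>i=1..n \<sigma>. \<Sum>j=1..n ?\<rho>. frag_of (u ?\<rho> j * z, ?b i j * v \<sigma> i)) =
      (\<Sum>j=1..n ?\<rho>. \<Sum>i=1..n \<sigma>. frag_of (u ?\<rho> j * z, ?b i j * v \<sigma> i))"
    by (rule sum.swap)
  also have "tensor_class B \<dots> = tensor_class B (\<Sum>j=1..n ?\<rho>. frag_of (u ?\<rho> j * z, v ?\<rho> j * a))"
    by (rule tensor_class_sum_cong[OF right])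
  finally show ?thesis .
qed

lemma separable_if_trace:
  assumes "\<And>e. e \<in> identities G \<Longrightarrow>
    finite (isotropy G e) \<and> \<one> e \<in> trace_at G n u v e ` ring_center (R e)"
  shows "separable_extension B"
proof -
  have "\<exists>z. e \<in> identities G \<longrightarrow> z \<in> ring_center (R e) \<and> trace_at G n u v e z = \<one> e" for e
    using assms[of e] by (cases "e \<in> identities G") (auto simp: image_iff)
  then obtain z where z: "\<And>e. e \<in> identities G \<Longrightarrow> z e \<in> ring_center (R e)"
    "\<And>e. e \<in> identities G \<Longrightarrow> trace_at G n u v e (z e) = \<one> e"
    by metis
  \<comment> \<open>All morphisms start at \<open>base e\<close>, so the elements \<open>T e\<close>
    of one component share the same central element; \<open>T_comm\<close> relies on this.\<close>
  define T where "T e = (\<Sum>\<sigma>\<in>hom (base e) e. \<Sum>i=1..n \<sigma>. frag_of (u \<sigma> i * z (base e), v \<sigma> i))" for e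
  have T_left: "free_lmult (\<one> e) (T e) = T e" if "e \<in> identities G" for e
    unfolding T_def free_lmult_sum
    by (intro sum.cong) (use one_left u_in in \<open>auto simp: hom_def simp flip: mult.assoc\<close>)
  have T_right: "free_rmult (T e) (\<one> e) = T e" if "e \<in> identities G" for e
    unfolding T_def free_rmult_sum
  proof (intro sum.cong refl)
    fix \<sigma> i assume "\<sigma> \<in> hom (base e) e" "i \<in> {1..n \<sigma>}"
    then have "v \<sigma> i * \<one> e = v \<sigma> i"
      using one_right[of "iv \<sigma>" "v \<sigma> i"] v_in by (auto simp: hom_def)
    then show "free_rmult (frag_of (u \<sigma> i * z (base e), v \<sigma> i)) (\<one> e) =
        frag_of (u \<sigma> i * z (base e), v \<sigma> i)"
      by simp
  qed
  have T_comm: "tensor_class B (free_lmult a (T (d \<tau>))) = tensor_class B (free_rmult (T (r \<tau>)) a)"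
    if \<tau>: "\<tau> \<in> M" "a \<in> R \<tau>" for \<tau> a
  proof -
    let ?p = "base (d \<tau>)"
    have p: "base (r \<tau>) = ?p" "z ?p \<in> ring_center (R ?p)"
      using \<tau> base_eq base(1) z(1) by simp_all
    have "tensor_class B (free_lmult a (T (d \<tau>))) = tensor_class B
        (\<Sum>\<sigma>\<in>hom ?p (d \<tau>). \<Sum>i=1..n \<sigma>. frag_of (a * (u \<sigma> i * z ?p), v \<sigma> i))"
      by (simp add: T_def free_lmult_sum)
    also have "\<dots> = tensor_class B (\<Sum>\<sigma>\<in>hom ?p (d \<tau>). \<Sum>j=1..n (\<tau> \<cdot> \<sigma>).
        frag_of (u (\<tau> \<cdot> \<sigma>) j * z ?p, v (\<tau> \<cdot> \<sigma>) j * a))"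
      using \<tau> p by (intro tensor_class_sum_cong dual_basis_comm) (auto simp: hom_def)
    \<comment> \<open>Left translation by \<open>\<tau>\<close> permutes the summands of
      \<open>T (d \<tau>)\<close> onto those of \<open>T (r \<tau>)\<close>.\<close>
    also have "(\<Sum>\<sigma>\<in>hom ?p (d \<tau>). \<Sum>j=1..n (\<tau> \<cdot> \<sigma>).
        frag_of (u (\<tau> \<cdot> \<sigma>) j * z ?p, v (\<tau> \<cdot> \<sigma>) j * a)) =
        (\<Sum>\<rho>\<in>hom ?p (r \<tau>). \<Sum>j=1..n \<rho>. frag_of (u \<rho> j * z ?p, v \<rho> j * a))"
      by (rule sum.reindex_bij_betw[OF bij_betw_cmp_left[OF \<tau>(1)]])
    also have "\<dots> = free_rmult (T (r \<tau>)) a"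
      by (simp add: T_def free_rmult_sum p)
    finally show ?thesis .
  qed
  \<comment> \<open>At the base object the product is literally the trace of \<open>z\<close>. For
    other objects it is transported along some \<open>\<tau>\<close> from the base: multiplying out
    \<open>T_comm\<close> shows that \<open>free_mult (T e)\<close> fixes every
    \<open>u \<tau> i\<close>, hence also the sum of the \<open>u \<tau> i * v \<tau> i\<close>,
    which is \<open>\<one> e\<close>.\<close>
  have "free_mult (T e) = \<one> e" if e: "e \<in> identities G" for e
  proof -
    let ?q = "base e"
    have q: "?q \<in> identities G" using base e by blast
    obtain \<tau> where \<tau>: "\<tau> \<in> M" "d \<tau> = ?q" "r \<tau> = e" using base(2)[OF e] by (auto simp: hom_def)
    have "base ?q = ?q" using base_eq[OF \<tau>(1)] \<tau> by simp
    then have "free_mult (T ?q) = trace_at G n u v ?q (z ?q)"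
      by (simp add: T_def free_mult_sum trace_at_def gam_def isotropy_eq_hom)
    then have T_q: "free_mult (T ?q) = \<one> ?q" using z(2) q by simp
    have "free_mult (T e) * u \<tau> i = u \<tau> i" if i: "i \<in> {1..n \<tau>}" for i
      using free_mult_cong[OF T_comm[OF \<tau>(1) u_in[OF \<tau>(1) i]]] one_right[OF \<tau>(1) u_in[OF \<tau>(1) i]] \<tau> T_q
      by (simp add: free_mult_lmult free_mult_rmult)
    then have "free_mult (T e) * (\<Sum>i=1..n \<tau>. u \<tau> i * v \<tau> i) = (\<Sum>i=1..n \<tau>. u \<tau> i * v \<tau> i)"
      by (simp add: sum_distrib_left flip: mult.assoc)
    then have "free_mult (T e) * \<one> e = \<one> e" using sum_u_v[OF \<tau>(1)] \<tau> by simp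
    then show ?thesis using T_right[OF e] by (simp flip: free_mult_rmult)
  qed
  then show ?thesis by (intro separable_if_commuting_family[OF T_left T_right _ T_comm])
qed

end

theorem theorem1:
  fixes G :: "'g category"
    and R :: "'g \<Rightarrow> 'r::ring set"
    and n :: "'g \<Rightarrow> nat"
    and u v :: "'g \<Rightarrow> nat \<Rightarrow> 'r"
  assumes "groupoid G"
    and "object_unital G R"
    and "strongly_graded G R"
    and "\<forall>e\<in>identities G. one_of (R e) \<noteq> 0"
    and "trace_choice G R n u v"
  shows "separable_extension (principal_subring G R) \<longleftrightarrow>
    (\<forall>e\<in>identities G. finite (isotropy G e) \<and>
       one_of (R e) \<in> trace_at G n u v e ` ring_center (R e))"
proof -
  have "graded_ring G R" using assms(3) by (simp add: strongly_graded_def)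
  moreover from this have "is_direct_sum (mor G) R" unfolding graded_ring_def by (rule conjunct1)
  ultimately interpret graded_ring_with_trace G R n u v
    using assms(1,2,5) by unfold_locales
  show ?thesis using assms(4) trace_if_separable separable_if_trace by blast
qed

end
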